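(* Let $G$ be a just infinite profinite group. (i) Suppose there is a proper open subgroup $H$ of $G$ isomorphic to $G$ itself. Then $G$ is virtually abelian. (ii) Suppose $G$ has infinitely many distinct radicals. Then $G$ is index-stable.
   Context: All subgroups are closed, homomorphisms (and isomorphisms) are continuous, and generation is topological. A profinite group is just infinite if it is infinite and every non-trivial normal subgroup has finite index. For a class $\mathcal{X}$ of profinite groups (closed under isomorphism), the $\mathcal{X}$-radical $O_{\mathcal{X}}(G)$ of a profinite group $G$ is the subgroup generated by all subnormal subgroups of $G$ that belong to $\mathcal{X}$. A radical of $G$ is a subgroup which is the $\mathcal{X}$-radical of $G$ for some class $\mathcal{X}$. A profinite group $G$ is index-unstable if it has a pair of isomorphic open subgroups of different indices in $G$, and index-stable otherwise. *)

theory Defs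
  imports "HOL-Analysis.Analysis" "HOL-Algebra.Generated_Groups"
begin

definition totally_disconnected_space :: "'a topology \<Rightarrow> bool" where
  "totally_disconnected_space X \<longleftrightarrow> (\<forall>S. connectedin X S \<longrightarrow> (\<exists>a. S \<subseteq> {a}))"

locale topological_group = group G for G :: "('a, 'b) monoid_scheme" (structure) +
  fixes T :: "'a topology"
  assumes topspace_eq: "topspace T = carrier G"
    and continuous_mult: "continuous_map (prod_topology T T) T (\<lambda>(x, y). x \<otimes> y)"
    and continuous_inv: "continuous_map T T (\<lambda>x. inv x)"

locale profinite_group = topological_group +
  assumes compact: "compact_space T"
    and Hausdorff: "Hausdorff_space T"
    and totally_disconnected: "totally_disconnected_space T"

definition closed_subgroup :: "('a, 'b) monoid_scheme \<Rightarrow> 'a topology \<Rightarrow> 'a set \<Rightarrow> bool" where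
  "closed_subgroup G T H \<longleftrightarrow> subgroup H G \<and> closedin T H"

definition open_subgroup :: "('a, 'b) monoid_scheme \<Rightarrow> 'a topology \<Rightarrow> 'a set \<Rightarrow> bool" where
  "open_subgroup G T H \<longleftrightarrow> subgroup H G \<and> openin T H"

definition top_isomorphic ::
  "('a, 'c) monoid_scheme \<Rightarrow> 'a topology \<Rightarrow> ('b, 'd) monoid_scheme \<Rightarrow> 'b topology \<Rightarrow> bool" where
  "top_isomorphic G T H U \<longleftrightarrow> (\<exists>f \<in> Group.iso G H. homeomorphic_map T U f)"

definition just_infinite :: "('a, 'b) monoid_scheme \<Rightarrow> 'a topology \<Rightarrow> bool" where
  "just_infinite G T \<longleftrightarrow> infinite (carrier G) \<and>
     (\<forall>N. N \<lhd> G \<and> closedin T N \<and> N \<noteq> {\<one>\<^bsub>G\<^esub>} \<longrightarrow> finite (rcosets\<^bsub>G\<^esub> N))"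

definition virtually_abelian :: "('a, 'b) monoid_scheme \<Rightarrow> 'a topology \<Rightarrow> bool" where
  "virtually_abelian G T \<longleftrightarrow>
     (\<exists>A. closed_subgroup G T A \<and> finite (rcosets\<^bsub>G\<^esub> A) \<and> comm_group (G\<lparr>carrier := A\<rparr>))"

text \<open>Every term of the subnormal series is closed, as all subgroups are.\<close>

inductive closed_subnormal :: "('a, 'b) monoid_scheme \<Rightarrow> 'a topology \<Rightarrow> 'a set \<Rightarrow> bool"
  for G :: "('a, 'b) monoid_scheme" and T :: "'a topology" where
  whole: "closed_subnormal G T (carrier G)"
| step: "closed_subnormal G T K \<Longrightarrow> H \<lhd> (G\<lparr>carrier := K\<rparr>) \<Longrightarrow> closedin T H
    \<Longrightarrow> closed_subnormal G T H"

text \<open>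
  A class of profinite groups is represented by its members whose carrier lies in the type
  \<open>'a\<close>. For groups on \<open>'a\<close> this loses no radicals: the subgroups of such a group live on
  \<open>'a\<close>, and every collection on \<open>'a\<close> closed under isomorphism is the trace of its closure
  under isomorphism among all profinite groups.
\<close>

definition profinite_class :: "('a monoid \<times> 'a topology) set \<Rightarrow> bool" where
  "profinite_class \<X> \<longleftrightarrow>
     (\<forall>(G, T) \<in> \<X>. profinite_group G T) \<and>
     (\<forall>G T H U. (G, T) \<in> \<X> \<and> profinite_group H U \<and> top_isomorphic G T H U
        \<longrightarrow> (H, U) \<in> \<X>)"

definition class_radical ::
  "('a monoid \<times> 'a topology) set \<Rightarrow> 'a monoid \<Rightarrow> 'a topology \<Rightarrow> 'a set" where
  "class_radical \<X> G T =
     T closure_of (generate G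
       (\<Union>{S. closed_subnormal G T S \<and> (G\<lparr>carrier := S\<rparr>, subtopology T S) \<in> \<X>}))"

definition is_radical :: "'a monoid \<Rightarrow> 'a topology \<Rightarrow> 'a set \<Rightarrow> bool" where
  "is_radical G T R \<longleftrightarrow> (\<exists>\<X>. profinite_class \<X> \<and> R = class_radical \<X> G T)"

text \<open>Open subgroups of a profinite group have finite index, so \<^const>\<open>card\<close> is the true
  index below.\<close>

definition index_unstable :: "('a, 'b) monoid_scheme \<Rightarrow> 'a topology \<Rightarrow> bool" where
  "index_unstable G T \<longleftrightarrow>
     (\<exists>H K. open_subgroup G T H \<and> open_subgroup G T K \<and>
        top_isomorphic (G\<lparr>carrier := H\<rparr>) (subtopology T H) (G\<lparr>carrier := K\<rparr>) (subtopology T K) \<and>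
        card (rcosets\<^bsub>G\<^esub> H) \<noteq> card (rcosets\<^bsub>G\<^esub> K))"

definition index_stable :: "('a, 'b) monoid_scheme \<Rightarrow> 'a topology \<Rightarrow> bool" where
  "index_stable G T \<longleftrightarrow> \<not> index_unstable G T"

end

theory Submission
  imports Defs
begin

text \<open>
  Both parts rest on a finiteness property of a just infinite profinite group \<open>G\<close>: for every open
  subgroup \<open>H\<close>, all but finitely many closed normal subgroups of \<open>G\<close> lie in \<open>H\<close>
  (\<open>finitely_many_closed_normal_not_below\<close>). It follows by compactness once each closed normal
  \<open>M\<close> is known to have only finitely many maximal \<open>G\<close>-normal subgroups (\<open>finite_chief_below\<close>). An
  infinite descending chain or an infinite family of closed normal subgroups always has trivial
  intersection, because a non-trivial one has finite index.

  For part (i), let \<open>\<phi>\<close> be an isomorphism of \<open>G\<close> onto the proper open subgroup \<open>H\<close>. Taking preimages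
  under \<open>\<phi>\<close> maps the non-trivial closed normal subgroups of \<open>G\<close> inside \<open>H\<close> injectively to non-trivial
  closed normal subgroups of \<open>G\<close>, and it lowers the index. As only finitely many closed normal
  subgroups are not inside \<open>H\<close>, following this map shows that all but finitely many lie in its image
  (\<open>finite_image_not_normal\<close>); for these, \<open>\<phi>(N)\<close> is again normal in \<open>G\<close>. Hence some \<open>N\<close> has all
  iterated images \<open>\<phi>\<^sup>i(N)\<close> normal in \<open>G\<close>, and these shrink below every open subgroup. If \<open>N\<close> were not
  abelian, some section \<open>N / \<phi>\<^sup>m(N)\<close> would not be. But the centralizers in \<open>G\<close> of the isomorphic
  sections \<open>\<phi>\<^sup>i(N) / \<phi>\<^sup>i\<^sup>+\<^sup>m(N)\<close> have bounded index, so there are finitely many of them and a common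
  \<open>\<phi>\<^sup>k(N)\<close> lies in all of them; taking \<open>i = k\<close> makes the section abelian
  (\<open>iterates_normal_imp_abelian\<close>).

  For part (ii), a radical \<open>R\<close> is normal and contains every subnormal subgroup of \<open>G\<close> isomorphic to it
  (\<open>image_class_radical_subset\<close>). If there are infinitely many radicals, non-trivial ones lie in every
  open subgroup. For an isomorphism \<open>f\<close> between open subgroups \<open>H\<close> and \<open>K\<close>, a sufficiently small
  radical \<open>R\<close> has subnormal images under \<open>f\<close> and its inverse, so \<open>f(R) = R\<close> and \<open>H\<close>, \<open>K\<close> have the same
  index.
\<close>

section \<open>Cosets and the index of a subgroup\<close>

context group
begin

lemma inv_mult_cancel:
  assumes "x \<in> carrier G" "y \<in> carrier G"
  shows "x \<otimes> (inv x \<otimes> y) = y" "inv x \<otimes> (x \<otimes> y) = y"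
  using assms by (simp_all add: m_assoc[symmetric])

lemma r_coset_eq_iff:
  assumes "subgroup H G" "x \<in> carrier G" "y \<in> carrier G"
  shows "H #> x = H #> y \<longleftrightarrow> x \<otimes> inv y \<in> H"
proof
  assume "H #> x = H #> y"
  then have "x \<in> H #> y" using rcos_self[OF assms(2,1)] by simp
  then show "x \<otimes> inv y \<in> H"
    using subgroup.rcos_module_imp[OF assms(1) is_group assms(3)] by simp
next
  assume "x \<otimes> inv y \<in> H"
  then have "x \<in> H #> y"
    using subgroup.rcos_module_rev[OF assms(1) is_group assms(3,2)] by simp
  then show "H #> x = H #> y" using repr_independence[OF _ assms(3,1)] by simp
qed

text \<open>A map on \<open>G\<close> that separates the cosets of \<open>K\<close> bounds the index of \<open>K\<close>; it need not be
  constant on cosets.\<close>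

lemma finite_index_by_map:
  assumes K: "subgroup K G" and f: "f \<in> carrier G \<rightarrow> X" and "finite X"
    and sep: "\<And>x y. \<lbrakk>x \<in> carrier G; y \<in> carrier G; f x = f y\<rbrakk> \<Longrightarrow> x \<otimes> inv y \<in> K"
  shows "finite (rcosets K)" and "card (rcosets K) \<le> card X"
proof -
  define r where "r c = (SOME x. x \<in> carrier G \<and> c = K #> x)" for c
  have r: "r c \<in> carrier G" "K #> r c = c" if "c \<in> rcosets K" for c
  proof -
    have "\<exists>x. x \<in> carrier G \<and> c = K #> x" using that by (auto simp: RCOSETS_def)
    then have "r c \<in> carrier G \<and> c = K #> r c" unfolding r_def by (rule someI_ex)
    then show "r c \<in> carrier G" "K #> r c = c" by auto
  qed
  have inj: "inj_on (f \<circ> r) (rcosets K)"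
  proof (rule inj_onI)
    fix c d assume c: "c \<in> rcosets K" and d: "d \<in> rcosets K" and eq: "(f \<circ> r) c = (f \<circ> r) d"
    have "r c \<otimes> inv (r d) \<in> K" using sep r[OF c] r[OF d] eq by simp
    then have "K #> r c = K #> r d" using r_coset_eq_iff[OF K, of "r c" "r d"] r[OF c] r[OF d] by blast
    then show "c = d" using r[OF c] r[OF d] by simp
  qed
  have sub: "(f \<circ> r) ` (rcosets K) \<subseteq> X" using r f by auto
  show "finite (rcosets K)" "card (rcosets K) \<le> card X"
    using inj_on_finite[OF inj sub \<open>finite X\<close>] card_inj_on_le[OF inj sub \<open>finite X\<close>] by auto
qed

lemma finite_index_Int:
  assumes H: "subgroup H G" and K: "subgroup K G"
    and fin: "finite (rcosets H)" "finite (rcosets K)"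
  shows "finite (rcosets (H \<inter> K))"
proof (rule finite_index_by_map(1)[where f = "\<lambda>x. (H #> x, K #> x)" and X = "(rcosets H) \<times> (rcosets K)"])
  show "subgroup (H \<inter> K) G" using subgroups_Inter_pair[OF H K] .
  show "x \<otimes> inv y \<in> H \<inter> K" if "x \<in> carrier G" "y \<in> carrier G" "(H #> x, K #> x) = (H #> y, K #> y)"
    for x y
    using that r_coset_eq_iff[OF H that(1,2)] r_coset_eq_iff[OF K that(1,2)] by simp
qed (use fin in \<open>auto simp: RCOSETS_def\<close>)

text \<open>A subgroup containing \<open>K\<close> is determined by the cosets of \<open>K\<close> that it contains.\<close>

lemma finite_overgroups:
  assumes K: "subgroup K G" and "finite (rcosets K)"
  shows "finite {L. subgroup L G \<and> K \<subseteq> L}"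
proof (rule inj_on_finite[where f = "\<lambda>L. {c \<in> rcosets K. c \<subseteq> L}" and B = "Pow (rcosets K)"])
  show "inj_on (\<lambda>L. {c \<in> rcosets K. c \<subseteq> L}) {L. subgroup L G \<and> K \<subseteq> L}"
  proof (rule inj_onI)
    have eq: "\<Union>{c \<in> rcosets K. c \<subseteq> L} = L" if L: "subgroup L G" "K \<subseteq> L" for L
    proof -
      have "\<exists>c\<in>rcosets K. c \<subseteq> L \<and> x \<in> c" if x: "x \<in> L" for x
      proof (intro bexI conjI)
        have xG: "x \<in> carrier G" using subgroup.mem_carrier[OF L(1) x] .
        show "K #> x \<in> rcosets K" "x \<in> K #> x"
          using rcosetsI[OF subgroup.subset[OF K] xG] rcos_self[OF xG K] by auto
        show "K #> x \<subseteq> L" using subgroup.m_closed[OF L(1) _ x] L(2) by (auto simp: r_coset_def)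
      qed
      then show ?thesis by blast
    qed
    fix L M
    assume L: "L \<in> {L. subgroup L G \<and> K \<subseteq> L}" and M: "M \<in> {L. subgroup L G \<and> K \<subseteq> L}"
      and same: "{c \<in> rcosets K. c \<subseteq> L} = {c \<in> rcosets K. c \<subseteq> M}"
    have "\<Union>{c \<in> rcosets K. c \<subseteq> L} = L" using L eq[of L] by blast
    moreover have "\<Union>{c \<in> rcosets K. c \<subseteq> M} = M" using M eq[of M] by blast
    ultimately show "L = M" using same by argo
  qed
  show "(\<lambda>L. {c \<in> rcosets K. c \<subseteq> L}) ` {L. subgroup L G \<and> K \<subseteq> L} \<subseteq> Pow (rcosets K)" by auto
  show "finite (Pow (rcosets K))" using assms by simp
qed

text \<open>Neither index is assumed finite: an infinite index makes both sides \<open>0\<close>.\<close>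

lemma index_mult:
  assumes R: "subgroup R G" and H: "subgroup H G" and RH: "R \<subseteq> H"
  shows "card (rcosets R) = card (rcosets H) * card (rcosets\<^bsub>G\<lparr>carrier := H\<rparr>\<^esub> R)"
proof -
  let ?Q = "rcosets\<^bsub>G\<lparr>carrier := H\<rparr>\<^esub> R"
  have Q: "?Q = {R #> h | h. h \<in> H}" by (auto simp: RCOSETS_def)
  define r where "r e = (SOME x. x \<in> carrier G \<and> e = H #> x)" for e
  have r: "r e \<in> carrier G" "H #> r e = e" if "e \<in> rcosets H" for e
  proof -
    have "\<exists>x. x \<in> carrier G \<and> e = H #> x" using that by (auto simp: RCOSETS_def)
    then have "r e \<in> carrier G \<and> e = H #> r e" unfolding r_def by (rule someI_ex)
    then show "r e \<in> carrier G" "H #> r e = e" by auto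
  qed
  have HG: "H \<subseteq> carrier G" and RG: "R \<subseteq> carrier G" using R H subgroup.subset by auto
  have coset: "(R #> h) #> t = R #> (h \<otimes> t)" if "h \<in> H" "t \<in> carrier G" for h t
    using that HG RG coset_mult_assoc by blast
  have "bij_betw (\<lambda>(e, c). c #> r e) ((rcosets H) \<times> ?Q) (rcosets R)"
    unfolding bij_betw_def
  proof (intro conjI inj_onI subset_antisym subsetI)
    fix p q assume p: "p \<in> (rcosets H) \<times> ?Q" and q: "q \<in> (rcosets H) \<times> ?Q"
      and eq: "(\<lambda>(e, c). c #> r e) p = (\<lambda>(e, c). c #> r e) q"
    obtain e h where p': "p = (e, R #> h)" "e \<in> rcosets H" "h \<in> H" using p Q by auto
    obtain e' h' where q': "q = (e', R #> h')" "e' \<in> rcosets H" "h' \<in> H" using q Q by auto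
    have re: "r e \<in> carrier G" "r e' \<in> carrier G" and hG: "h \<in> carrier G" "h' \<in> carrier G"
      using r p' q' HG by auto
    have *: "R #> (h \<otimes> r e) = R #> (h' \<otimes> r e')" using eq p' q' coset re by auto
    then have a: "h \<otimes> r e \<otimes> inv (h' \<otimes> r e') \<in> R"
      using r_coset_eq_iff[OF R] re hG by simp
    then have "inv h \<otimes> (h \<otimes> r e \<otimes> inv (h' \<otimes> r e')) \<otimes> h' \<in> H"
      using subgroup.m_closed[OF H subgroup.m_closed[OF H subgroup.m_inv_closed[OF H p'(3)]
            subsetD[OF RH]] q'(3)] by blast
    then have "r e \<otimes> inv (r e') \<in> H"
      using re hG by (simp add: inv_mult_group m_assoc inv_mult_cancel)
    then have "H #> r e = H #> r e'" using r_coset_eq_iff[OF H] re by simp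
    then have ee: "e = e'" using r(2)[OF p'(2)] r(2)[OF q'(2)] by simp
    have "h \<otimes> inv h' \<in> R" using a re hG ee by (simp add: inv_mult_group m_assoc inv_mult_cancel)
    then show "p = q" using p' q' ee r_coset_eq_iff[OF R] hG by simp
  next
    fix y assume "y \<in> (\<lambda>(e, c). c #> r e) ` ((rcosets H) \<times> ?Q)"
    then obtain e h where y: "y = (R #> h) #> r e" "e \<in> rcosets H" "h \<in> H" using Q by auto
    then have "y = R #> (h \<otimes> r e)" "h \<otimes> r e \<in> carrier G" using coset r HG by auto
    then show "y \<in> rcosets R" using RG by (simp add: rcosetsI)
  next
    fix y assume "y \<in> rcosets R"
    then obtain g where g: "g \<in> carrier G" "y = R #> g" by (auto simp: RCOSETS_def)
    let ?e = "H #> g"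
    have e: "?e \<in> rcosets H" using g HG by (simp add: rcosetsI)
    have "g \<otimes> inv (r ?e) \<in> H" using r_coset_eq_iff[OF H g(1) r(1)[OF e]] r(2)[OF e] by simp
    moreover have "(R #> (g \<otimes> inv (r ?e))) #> r ?e = y"
      using coset calculation r[OF e] g by (simp add: m_assoc)
    ultimately show "y \<in> (\<lambda>(e, c). c #> r e) ` ((rcosets H) \<times> ?Q)"
      using e Q by (intro image_eqI[where x = "(?e, R #> (g \<otimes> inv (r ?e)))"]) auto
  qed
  then show ?thesis by (metis bij_betw_same_card card_cartesian_product)
qed

lemma normal_set_mult:
  assumes A: "A \<lhd> G" and B: "B \<lhd> G"
  shows "(A <#> B) \<lhd> G"
proof -
  have AG: "A \<subseteq> carrier G" "B \<subseteq> carrier G" and sA: "subgroup A G" "subgroup B G"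
    using normal_imp_subgroup[OF A] normal_imp_subgroup[OF B] subgroup.subset by auto
  have conj: "g \<otimes> x \<otimes> inv g \<in> A <#> B" if x: "x \<in> A <#> B" and g: "g \<in> carrier G" for x g
  proof -
    obtain a b where ab: "x = a \<otimes> b" "a \<in> A" "b \<in> B" using x by (auto simp: set_mult_def)
    have "g \<otimes> x \<otimes> inv g = (g \<otimes> a \<otimes> inv g) \<otimes> (g \<otimes> b \<otimes> inv g)"
      using ab AG g by (simp add: m_assoc inv_mult_cancel subset_eq)
    moreover have "g \<otimes> a \<otimes> inv g \<in> A" "g \<otimes> b \<otimes> inv g \<in> B"
      using normal.inv_op_closed2[OF A g ab(2)] normal.inv_op_closed2[OF B g ab(3)] by auto
    ultimately show ?thesis unfolding set_mult_def by auto
  qed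
  have mult: "x \<otimes> y \<in> A <#> B" if x: "x \<in> A <#> B" and y: "y \<in> A <#> B" for x y
  proof -
    obtain a b c d where *: "x = a \<otimes> b" "y = c \<otimes> d" "a \<in> A" "b \<in> B" "c \<in> A" "d \<in> B"
      using x y by (auto simp: set_mult_def)
    have "x \<otimes> y = (a \<otimes> c) \<otimes> ((inv c \<otimes> b \<otimes> c) \<otimes> d)"
      using * AG by (simp add: m_assoc inv_mult_cancel subset_eq)
    moreover have "inv c \<otimes> b \<otimes> c \<in> B"
      using normal.inv_op_closed1[OF B subsetD[OF AG(1) *(5)] *(4)] .
    then have "(inv c \<otimes> b \<otimes> c) \<otimes> d \<in> B" using subgroup.m_closed[OF sA(2) _ *(6)] by simp
    moreover have "a \<otimes> c \<in> A" using subgroup.m_closed[OF sA(1) *(3,5)] .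
    ultimately show ?thesis unfolding set_mult_def by auto
  qed
  have inv: "inv x \<in> A <#> B" if x: "x \<in> A <#> B" for x
  proof -
    obtain a b where *: "x = a \<otimes> b" "a \<in> A" "b \<in> B" using x by (auto simp: set_mult_def)
    have "inv x = inv a \<otimes> (a \<otimes> inv b \<otimes> inv a)"
      using * AG by (simp add: m_assoc inv_mult_cancel inv_mult_group subset_eq)
    moreover have "a \<otimes> inv b \<otimes> inv a \<in> B"
      using normal.inv_op_closed2[OF B subsetD[OF AG(1) *(2)] subgroup.m_inv_closed[OF sA(2) *(3)]] .
    ultimately show ?thesis using * sA unfolding set_mult_def
      by (auto intro: subgroup.m_inv_closed)
  qed
  have "\<one> \<in> A <#> B"
    using subgroup.one_closed[OF sA(1)] subgroup.one_closed[OF sA(2)] r_one[OF one_closed]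
    unfolding set_mult_def by blast
  moreover have "A <#> B \<subseteq> carrier G" using AG setmult_subset_G by blast
  ultimately have "subgroup (A <#> B) G" using mult inv by (intro subgroup.intro) auto
  then show ?thesis using conj normal_inv_iff by blast
qed

lemma normal_Inter:
  assumes "A \<noteq> {}" "\<And>N. N \<in> A \<Longrightarrow> N \<lhd> G"
  shows "\<Inter>A \<lhd> G"
proof -
  have "subgroup (\<Inter>A) G"
    using assms subgroups_Inter[of A] normal_imp_subgroup by blast
  then show ?thesis using assms normal_inv_iff by auto
qed

end

lemma iso_index:
  assumes A: "group A" and B: "group B" and f: "f \<in> iso A B" and N: "subgroup N A"
  shows "card (rcosets\<^bsub>B\<^esub> (f ` N)) = card (rcosets\<^bsub>A\<^esub> N)"
proof -
  have h: "f \<in> hom A B" "inj_on f (carrier A)" "f ` carrier A = carrier B"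
    using f by (auto simp: iso_def bij_betw_def)
  have NA: "N \<subseteq> carrier A" using subgroup.subset[OF N] .
  have c: "f ` (N #>\<^bsub>A\<^esub> x) = (f ` N) #>\<^bsub>B\<^esub> (f x)" if "x \<in> carrier A" for x
  proof -
    have "f (n \<otimes>\<^bsub>A\<^esub> x) = f n \<otimes>\<^bsub>B\<^esub> f x" if "n \<in> N" for n
      using hom_mult[OF h(1)] NA that \<open>x \<in> carrier A\<close> by blast
    then show ?thesis by (simp add: r_coset_def image_UN cong: SUP_cong)
  qed
  have "rcosets\<^bsub>B\<^esub> (f ` N) = (\<lambda>c. f ` c) ` (rcosets\<^bsub>A\<^esub> N)"
  proof -
    have "rcosets\<^bsub>B\<^esub> (f ` N) = (\<lambda>y. (f ` N) #>\<^bsub>B\<^esub> y) ` (f ` carrier A)"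
      using h(3) by (auto simp: RCOSETS_def)
    also have "\<dots> = (\<lambda>x. f ` (N #>\<^bsub>A\<^esub> x)) ` carrier A" using c by (simp add: image_image)
    also have "\<dots> = (\<lambda>c. f ` c) ` (rcosets\<^bsub>A\<^esub> N)" by (auto simp: RCOSETS_def)
    finally show ?thesis .
  qed
  moreover have "inj_on (\<lambda>c. f ` c) (rcosets\<^bsub>A\<^esub> N)"
    using h(2) group.rcosets_subset_PowG[OF A N] 
    by (intro inj_on_subset[OF inj_on_image_Pow])
  ultimately show ?thesis by (simp add: card_image)
qed

section \<open>Topological isomorphisms\<close>

text \<open>\<open>f\<close> is an isomorphism of the group \<open>A\<close> with topology \<open>U\<close> onto the group \<open>B\<close> with
  topology \<open>V\<close>.\<close>

definition topological_iso where
  "topological_iso A U B V f \<longleftrightarrow> f \<in> iso A B \<and> homeomorphic_map U V f"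

lemma top_isomorphic_iff: "top_isomorphic A U B V \<longleftrightarrow> (\<exists>f. topological_iso A U B V f)"
  by (auto simp: top_isomorphic_def topological_iso_def)

lemma topological_iso_restrict:
  assumes f: "topological_iso A U B V f" and S: "S \<subseteq> carrier A"
    and U: "topspace U = carrier A" and V: "topspace V = carrier B"
  shows "topological_iso (A\<lparr>carrier := S\<rparr>) (subtopology U S)
    (B\<lparr>carrier := f ` S\<rparr>) (subtopology V (f ` S)) f"
proof -
  have h: "f \<in> hom A B" "inj_on f (carrier A)" "f ` carrier A = carrier B" "homeomorphic_map U V f"
    using f by (auto simp: topological_iso_def iso_def bij_betw_def)
  have "f ` (topspace U \<inter> S) = topspace V \<inter> f ` S" using S U V h(3) by auto
  then have "homeomorphic_map (subtopology U S) (subtopology V (f ` S)) f"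
    using homeomorphic_map_subtopologies[OF h(4)] by blast
  moreover have "f \<in> iso (A\<lparr>carrier := S\<rparr>) (B\<lparr>carrier := f ` S\<rparr>)"
    using h(1,2) S by (auto simp: iso_def hom_def bij_betw_def subset_eq intro: inj_on_subset)
  ultimately show ?thesis by (simp add: topological_iso_def)
qed

lemma topological_iso_inverse:
  assumes f: "topological_iso A U B V f" and A: "group A"
    and U: "topspace U = carrier A" and V: "topspace V = carrier B"
  shows "topological_iso B V A U (inv_into (carrier A) f)"
proof -
  let ?g = "inv_into (carrier A) f"
  have h: "f \<in> iso A B" "homeomorphic_map U V f" using f by (auto simp: topological_iso_def)
  have bij: "inj_on f (carrier A)" "f ` carrier A = carrier B"
    using h(1) by (auto simp: iso_def bij_betw_def)
  obtain g where g: "homeomorphic_maps U V f g" using h(2) homeomorphic_map_maps by blast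
  have eq: "g y = ?g y" if y: "y \<in> topspace V" for y
  proof -
    have "g y \<in> carrier A" "f (g y) = y"
      using g y U unfolding homeomorphic_maps_def continuous_map_def by auto
    then show ?thesis using inv_into_f_f[OF bij(1), of "g y"] by simp
  qed
  have "homeomorphic_map V U g" using g homeomorphic_maps_map by blast
  then have "homeomorphic_map V U ?g" using homeomorphic_map_eq eq by blast
  then show ?thesis using group.iso_set_sym[OF A h(1)] by (simp add: topological_iso_def)
qed

section \<open>Closed and open subgroups of profinite groups\<close>

context topological_group
begin

lemma continuous_map_left: "a \<in> carrier G \<Longrightarrow> continuous_map T T (\<lambda>x. a \<otimes> x)"
  using continuous_map_compose[OF continuous_map_pairedI[of T T "\<lambda>_. a" T "\<lambda>x. x"] continuous_mult]
  by (simp add: o_def topspace_eq continuous_map_id[unfolded id_def])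

lemma continuous_map_right: "a \<in> carrier G \<Longrightarrow> continuous_map T T (\<lambda>x. x \<otimes> a)"
  using continuous_map_compose[OF continuous_map_pairedI[of T T "\<lambda>x. x" T "\<lambda>_. a"] continuous_mult]
  by (simp add: o_def topspace_eq continuous_map_id[unfolded id_def])

lemma homeomorphic_map_right:
  assumes "a \<in> carrier G"
  shows "homeomorphic_map T T (\<lambda>x. x \<otimes> a)"
proof -
  have "homeomorphic_maps T T (\<lambda>x. x \<otimes> a) (\<lambda>x. x \<otimes> inv a)"
    using assms continuous_map_right
    by (simp add: homeomorphic_maps_def topspace_eq m_assoc)
  then show ?thesis using homeomorphic_maps_map by blast
qed

lemma homeomorphic_map_conj:
  assumes "a \<in> carrier G"
  shows "homeomorphic_map T T (\<lambda>x. a \<otimes> x \<otimes> inv a)"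
proof -
  have c: "continuous_map T T (\<lambda>x. b \<otimes> x \<otimes> inv b)" if "b \<in> carrier G" for b
    using continuous_map_compose[OF continuous_map_left[OF that] continuous_map_right[OF inv_closed[OF that]]]
    by (simp add: o_def)
  have "homeomorphic_maps T T (\<lambda>x. a \<otimes> x \<otimes> inv a) (\<lambda>x. inv a \<otimes> x \<otimes> a)"
    using assms c[OF assms] c[OF inv_closed[OF assms]]
    by (simp add: homeomorphic_maps_def topspace_eq m_assoc inv_mult_cancel)
  then show ?thesis using homeomorphic_maps_map by blast
qed

lemma r_coset_eq_image: "H #> a = (\<lambda>x. x \<otimes> a) ` H"
  by (auto simp: r_coset_def)

lemma closedin_r_coset:
  assumes "closedin T H" "a \<in> carrier G"
  shows "closedin T (H #> a)"
  unfolding r_coset_eq_image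
  using homeomorphic_map_closedness[OF homeomorphic_map_right[OF assms(2)]] assms(1)
    closedin_subset by blast

lemma openin_r_coset:
  assumes "openin T H" "a \<in> carrier G"
  shows "openin T (H #> a)"
  unfolding r_coset_eq_image
  using homeomorphic_map_openness[OF homeomorphic_map_right[OF assms(2)]] assms(1)
    openin_subset by blast

lemma Union_rcosets_overgroup:
  assumes K: "subgroup K G" and L: "subgroup L G" and KL: "K \<subseteq> L"
  shows "L = \<Union>{c \<in> rcosets K. c \<subseteq> L}" "carrier G - L = \<Union>{c \<in> rcosets K. c \<inter> L = {}}"
proof -
  have coset: "K #> x \<in> rcosets K" "x \<in> K #> x" if "x \<in> carrier G" for x
    using rcosetsI[OF subgroup.subset[OF K] that] rcos_self[OF that K] by auto
  have sub: "c \<subseteq> carrier G" if "c \<in> rcosets K" for c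
    using that rcosets_subset_PowG[OF K] by blast
  have dich: "(K #> x) \<subseteq> L \<longleftrightarrow> x \<in> L" "(K #> x) \<inter> L = {} \<longleftrightarrow> x \<notin> L" if x: "x \<in> carrier G" for x
  proof -
    have *: "y \<in> L \<longleftrightarrow> x \<in> L" if y: "y \<in> K #> x" for y
    proof -
      obtain k where k: "k \<in> K" "y = k \<otimes> x" using y by (auto simp: r_coset_def)
      have kG: "k \<in> carrier G" using k K subgroup.subset by blast
      have kL: "k \<in> L" using k KL by blast
      have "x \<in> L" if "y \<in> L"
        using subgroup.m_closed[OF L subgroup.m_inv_closed[OF L kL] that] k x kG
        by (simp add: inv_mult_cancel)
      then show ?thesis using k subgroup.m_closed[OF L kL] by blast
    qed
    show "(K #> x) \<subseteq> L \<longleftrightarrow> x \<in> L" "(K #> x) \<inter> L = {} \<longleftrightarrow> x \<notin> L"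
      using * coset(2)[OF x] by blast+
  qed
  have LG: "L \<subseteq> carrier G" using subgroup.subset[OF L] .
  show "L = \<Union>{c \<in> rcosets K. c \<subseteq> L}"
  proof (intro subset_antisym subsetI)
    fix x assume x: "x \<in> L"
    then have "x \<in> carrier G" using LG by blast
    then show "x \<in> \<Union>{c \<in> rcosets K. c \<subseteq> L}" using coset[of x] dich(1)[of x] x by blast
  qed blast
  show "carrier G - L = \<Union>{c \<in> rcosets K. c \<inter> L = {}}"
  proof (intro subset_antisym subsetI)
    fix x assume x: "x \<in> carrier G - L"
    then show "x \<in> \<Union>{c \<in> rcosets K. c \<inter> L = {}}" using coset[of x] dich(2)[of x] by blast
  qed (use sub in blast)
qed

lemma rcosets_closedin:
  assumes "closedin T K" "c \<in> rcosets K"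
  shows "closedin T c"
  using assms closedin_r_coset by (auto simp: RCOSETS_def)

lemma closed_overgroup:
  assumes K: "subgroup K G" "closedin T K" "finite (rcosets K)"
    and L: "subgroup L G" "K \<subseteq> L"
  shows "closedin T L" "openin T L"
proof -
  have fin: "finite {c \<in> rcosets K. P c}" for P using K(3) by simp
  have "closedin T (\<Union>{c \<in> rcosets K. c \<subseteq> L})"
    by (rule closedin_Union[OF fin]) (use K rcosets_closedin in blast)
  then show "closedin T L" using Union_rcosets_overgroup(1)[OF K(1) L] by argo
  have "closedin T (\<Union>{c \<in> rcosets K. c \<inter> L = {}})"
    by (rule closedin_Union[OF fin]) (use K rcosets_closedin in blast)
  then have "closedin T (topspace T - L)"
    using Union_rcosets_overgroup(2)[OF K(1) L] topspace_eq by argo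
  then show "openin T L"
    using openin_closedin_eq subgroup.subset[OF L(1)] topspace_eq by blast
qed

lemma open_subgroup_closedin:
  assumes H: "subgroup H G" "openin T H"
  shows "closedin T H"
proof -
  have "openin T (\<Union>{c \<in> rcosets H. c \<inter> H = {}})"
    using openin_r_coset[OF H(2)] by (auto simp: RCOSETS_def)
  then have "openin T (topspace T - H)"
    using Union_rcosets_overgroup(2)[OF H(1) H(1) subset_refl] topspace_eq by argo
  then show ?thesis using closedin_def subgroup.subset[OF H(1)] topspace_eq by blast
qed

lemma open_subgroup_finite_index:
  assumes H: "subgroup H G" "openin T H" and "compact_space T"
  shows "finite (rcosets H)"
proof -
  have op: "openin T c" if "c \<in> rcosets H" for c
    using that openin_r_coset[OF H(2)] by (auto simp: RCOSETS_def)
  have cover: "topspace T \<subseteq> \<Union>(rcosets H)"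
    using rcosets_part_G[OF H(1)] topspace_eq by simp
  obtain F where F: "finite F" "F \<subseteq> rcosets H" "topspace T \<subseteq> \<Union>F"
    using \<open>compact_space T\<close> op cover unfolding compact_space_alt by meson
  have "c \<in> F" if c: "c \<in> rcosets H" for c
  proof -
    obtain x where x: "x \<in> carrier G" "c = H #> x" using c by (auto simp: RCOSETS_def)
    have xc: "x \<in> c" using x rcos_self H by blast
    obtain d where d: "d \<in> F" "x \<in> d" using F(3) x topspace_eq by blast
    have "d = c" using rcos_disjoint[OF H(1)] d F(2) c xc unfolding pairwise_def disjnt_def by blast
    then show ?thesis using d by simp
  qed
  then show ?thesis by (intro finite_subset[OF subsetI F(1)])
qed

end

text \<open>Closed normal subgroups, the normal subgroups in the topological sense.\<close>

definition closed_normal :: "('a, 'b) monoid_scheme \<Rightarrow> 'a topology \<Rightarrow> 'a set \<Rightarrow> bool" where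
  "closed_normal G T N \<longleftrightarrow> N \<lhd> G \<and> closedin T N"

locale just_infinite_profinite_group = profinite_group +
  assumes just_infinite: "just_infinite G T"
begin

lemma infinite_carrier: "infinite (carrier G)"
  using just_infinite by (simp add: just_infinite_def)

lemma closed_normal_finite_index:
  "closed_normal G T N \<Longrightarrow> N \<noteq> {\<one>} \<Longrightarrow> finite (rcosets N)"
  using just_infinite by (simp add: just_infinite_def closed_normal_def)

lemma finite_index_nontrivial:
  assumes "finite (rcosets N)"
  shows "N \<noteq> {\<one>}"
proof
  assume "N = {\<one>}"
  then have "(\<lambda>x. {x}) ` carrier G \<subseteq> rcosets N" by (force simp: RCOSETS_def r_coset_def)
  moreover have "infinite ((\<lambda>x. {x}) ` carrier G)"
    using infinite_carrier by (simp add: finite_image_iff)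
  ultimately show False using finite_subset[OF _ assms] by blast
qed

lemma closed_normal_subgroup: "closed_normal G T N \<Longrightarrow> subgroup N G"
  unfolding closed_normal_def using normal_imp_subgroup by blast

lemma closed_normal_carrier: "closed_normal G T (carrier G)"
  unfolding closed_normal_def
  using normal_inv_iff subgroup_self topspace_eq closedin_topspace[of T] by simp

lemma closed_normal_Inter:
  assumes "A \<noteq> {}" "\<And>N. N \<in> A \<Longrightarrow> closed_normal G T N"
  shows "closed_normal G T (\<Inter>A)"
  using assms normal_Inter[of A] closedin_Inter[of A T] unfolding closed_normal_def by simp

lemma closed_normal_Int:
  "closed_normal G T N \<Longrightarrow> closed_normal G T M \<Longrightarrow> closed_normal G T (N \<inter> M)"
  using closed_normal_Inter[of "{N, M}"] by auto

lemma closed_normal_Int_nontrivial: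
  assumes "closed_normal G T N" "closed_normal G T M" "N \<noteq> {\<one>}" "M \<noteq> {\<one>}"
  shows "N \<inter> M \<noteq> {\<one>}"
  using assms closed_normal_subgroup closed_normal_finite_index finite_index_Int
  by (intro finite_index_nontrivial) simp

lemma closed_normal_openin:
  assumes "closed_normal G T N" "N \<noteq> {\<one>}"
  shows "openin T N"
  using assms closed_overgroup(2)[of N N] closed_normal_subgroup closed_normal_finite_index
  unfolding closed_normal_def by simp

lemma closed_normal_set_mult:
  assumes "closed_normal G T N" "closed_normal G T M" "N \<noteq> {\<one>}"
  shows "closed_normal G T (N <#> M)"
proof -
  have n: "N <#> M \<lhd> G" using assms normal_set_mult unfolding closed_normal_def by simp
  have "\<one> \<in> M" using subgroup.one_closed[OF closed_normal_subgroup[OF assms(2)]] .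
  then have "N \<subseteq> N <#> M"
    using subgroup.subset[OF closed_normal_subgroup[OF assms(1)]] r_one
    unfolding set_mult_def by force
  then have "closedin T (N <#> M)"
    using closed_overgroup(1)[OF closed_normal_subgroup[OF assms(1)]] assms
      closed_normal_finite_index normal_imp_subgroup[OF n] unfolding closed_normal_def by blast
  then show ?thesis using n unfolding closed_normal_def by simp
qed

lemma finite_closed_normal_above:
  assumes "closed_normal G T N" "N \<noteq> {\<one>}"
  shows "finite {M. closed_normal G T M \<and> N \<subseteq> M}"
proof (rule finite_subset)
  show "{M. closed_normal G T M \<and> N \<subseteq> M} \<subseteq> {L. subgroup L G \<and> N \<subseteq> L}"
    using closed_normal_subgroup by blast
  show "finite {L. subgroup L G \<and> N \<subseteq> L}"
    using finite_overgroups closed_normal_subgroup closed_normal_finite_index assms by blast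
qed

text \<open>Only finitely many closed normal subgroups lie above a non-trivial one.\<close>

lemma infinite_family_Inter_trivial:
  assumes "infinite A" "\<And>N. N \<in> A \<Longrightarrow> closed_normal G T N"
  shows "\<Inter>A = {\<one>}"
proof (rule ccontr)
  assume nt: "\<Inter>A \<noteq> {\<one>}"
  have "A \<noteq> {}" using assms(1) by auto
  then have "closed_normal G T (\<Inter>A)" using closed_normal_Inter assms(2) by blast
  then have "finite {M. closed_normal G T M \<and> \<Inter>A \<subseteq> M}"
    using finite_closed_normal_above nt by blast
  moreover have "A \<subseteq> {M. closed_normal G T M \<and> \<Inter>A \<subseteq> M}" using assms(2) by blast
  ultimately show False using assms(1) by (simp add: finite_subset)
qed

lemma descending_chain:
  fixes C :: "nat \<Rightarrow> 'a set"
  assumes "\<And>n. closed_normal G T (C n)" "\<And>n. C (Suc n) \<subset> C n"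
  shows "decseq C" "(\<Inter>n. C n) = {\<one>}"
proof -
  show "decseq C" using assms(2) by (intro decseq_SucI) blast
  have "C n \<noteq> C m" if "m < n" for m n
    using that lift_Suc_mono_less[of "\<lambda>n. - C n" m n] assms(2) by blast
  then have "inj C" unfolding inj_def by (metis linorder_neqE_nat)
  then have "infinite (range C)" using range_inj_infinite by blast
  then show "(\<Inter>n. C n) = {\<one>}"
    using infinite_family_Inter_trivial[of "range C"] assms(1) by blast
qed

section \<open>Only finitely many closed normal subgroups avoid a given open subgroup\<close>

text \<open>\<open>P\<close> is maximal among the closed normal subgroups of \<open>G\<close> properly contained in \<open>M\<close>, that
  is, \<open>M / P\<close> is a chief factor of \<open>G\<close>.\<close>

definition chief_below :: "'a set \<Rightarrow> 'a set \<Rightarrow> bool" where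
  "chief_below P M \<longleftrightarrow> closed_normal G T P \<and> P \<subset> M \<and>
     (\<forall>Q. closed_normal G T Q \<and> P \<subseteq> Q \<and> Q \<subseteq> M \<longrightarrow> Q = P \<or> Q = M)"

lemma chief_below_exists:
  assumes N: "closed_normal G T N" "N \<noteq> {\<one>}" "N \<subset> M"
  shows "\<exists>P. chief_below P M \<and> N \<subseteq> P"
proof -
  define A where "A = {Q. closed_normal G T Q \<and> N \<subseteq> Q \<and> Q \<subset> M}"
  have fin: "finite A"
    unfolding A_def by (rule finite_subset[OF _ finite_closed_normal_above[OF N(1,2)]]) blast
  have NA: "N \<in> A" using N unfolding A_def by simp
  obtain P where P: "P \<in> A" "\<And>Q. Q \<in> A \<Longrightarrow> P \<subseteq> Q \<Longrightarrow> P = Q"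
    using finite_has_maximal2[OF fin NA] by auto
  have P': "closed_normal G T P" "N \<subseteq> P" "P \<subset> M" using P(1) unfolding A_def by auto
  have "Q = P \<or> Q = M" if Q: "closed_normal G T Q" "P \<subseteq> Q" "Q \<subseteq> M" for Q
  proof (cases "Q = M")
    case False
    then have "Q \<in> A" using Q P' unfolding A_def by auto
    then show ?thesis using P(2)[OF _ Q(2)] by simp
  qed simp
  then have "chief_below P M" unfolding chief_below_def using P' by simp
  then show ?thesis using P' by blast
qed

text \<open>If there were infinitely many such \<open>P\<close>, they would intersect trivially. Fix one of them. A
  closed normal \<open>C \<subseteq> M\<close> with \<open>C P = M\<close> can then always be replaced by a smaller one: choose \<open>P'\<close> of
  the family not containing the non-trivial \<open>C \<inter> P\<close>, so that \<open>(C \<inter> P) P' = M\<close> and therefore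
  \<open>(C \<inter> P') P = M\<close>. The resulting chain intersects trivially, yet by compactness its intersection is
  still a supplement of \<open>P\<close> in \<open>M\<close>, which forces \<open>P = M\<close>.\<close>

lemma finite_chief_below:
  assumes M: "closed_normal G T M"
  shows "finite {P. chief_below P M}"
proof (rule ccontr)
  assume inf: "infinite {P. chief_below P M}"
  have meet: "\<Inter>{P. chief_below P M} = {\<one>}"
    using infinite_family_Inter_trivial[OF inf] by (simp add: chief_below_def)
  obtain P where P: "chief_below P M" using inf not_finite_existsD by auto
  have Pn: "closed_normal G T P" and PM: "P \<subset> M" using P by (auto simp: chief_below_def)
  have MG: "M \<subseteq> carrier G" and PG: "P \<subseteq> carrier G"
    using subgroup.subset closed_normal_subgroup M Pn by blast+
  define supp where "supp C \<longleftrightarrow> closed_normal G T C \<and> C \<subseteq> M \<and> (\<forall>m\<in>M. \<exists>c\<in>C. \<exists>p\<in>P. m = c \<otimes> p)" for C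
  have "P \<noteq> {\<one>}"
  proof
    assume "P = {\<one>}"
    have "Q = P" if Q: "chief_below Q M" for Q
    proof -
      have "P \<subseteq> Q"
        using \<open>P = {\<one>}\<close> Q subgroup.one_closed closed_normal_subgroup unfolding chief_below_def by blast
      then show ?thesis using P Q unfolding chief_below_def by blast
    qed
    then have "{P. chief_below P M} \<subseteq> {P}" by blast
    then show False using inf by (simp add: finite_subset)
  qed
  \<comment> \<open>Every supplement has a properly smaller one.\<close>
  have shrink: "\<exists>D. supp D \<and> D \<subset> C" if C: "supp C" for C
  proof -
    have Cn: "closed_normal G T C" and CM: "C \<subseteq> M" using C by (auto simp: supp_def)
    have CG: "C \<subseteq> carrier G" using CM MG by blast
    have "C \<noteq> {\<one>}"
    proof
      assume C1: "C = {\<one>}"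
      have "m \<in> P" if m: "m \<in> M" for m
      proof -
        obtain p where "p \<in> P" "m = \<one> \<otimes> p" using C m C1 by (auto simp: supp_def)
        then show ?thesis using PG by auto
      qed
      then show False using PM by blast
    qed
    then have CP: "C \<inter> P \<noteq> {\<one>}" using closed_normal_Int_nontrivial Cn Pn \<open>P \<noteq> {\<one>}\<close> by blast
    have CPn: "closed_normal G T (C \<inter> P)" using closed_normal_Int Cn Pn by blast
    have "\<one> \<in> C \<inter> P" using subgroup.one_closed closed_normal_subgroup CPn by blast
    then obtain P' where P': "chief_below P' M" "\<not> C \<inter> P \<subseteq> P'"
      using CP meet by blast
    have P'n: "closed_normal G T P'" and P'M: "P' \<subset> M" using P' by (auto simp: chief_below_def)
    have P'G: "P' \<subseteq> carrier G" using P'M MG by blast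
    have prod: "(C \<inter> P) <#> P' = M"
    proof -
      let ?Q = "(C \<inter> P) <#> P'"
      have Qn: "closed_normal G T ?Q" using closed_normal_set_mult[OF CPn P'n CP] .
      have "?Q \<subseteq> M"
        using CM P'M subgroup.m_closed[OF closed_normal_subgroup[OF M]] unfolding set_mult_def by blast
      moreover have "P' \<subseteq> ?Q"
      proof
        fix x assume x: "x \<in> P'"
        then have "x = \<one> \<otimes> x" using P'G by auto
        then show "x \<in> ?Q" using x \<open>\<one> \<in> C \<inter> P\<close> unfolding set_mult_def by blast
      qed
      moreover have "C \<inter> P \<subseteq> ?Q"
      proof
        fix x assume x: "x \<in> C \<inter> P"
        then have "x = x \<otimes> \<one>" using CG by auto
        moreover have "\<one> \<in> P'" using subgroup.one_closed closed_normal_subgroup P'n by blast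
        ultimately show "x \<in> ?Q" using x unfolding set_mult_def by blast
      qed
      ultimately show ?thesis using P' Qn unfolding chief_below_def by blast
    qed
    have "\<exists>c\<in>C \<inter> P'. \<exists>p\<in>P. m = c \<otimes> p" if m: "m \<in> M" for m
    proof -
      obtain c p where cp: "c \<in> C" "p \<in> P" "m = c \<otimes> p" using C m by (auto simp: supp_def)
      have "c \<in> (C \<inter> P) <#> P'" using cp CM prod by blast
      then obtain a b where ab: "a \<in> C" "a \<in> P" "b \<in> P'" "c = a \<otimes> b" unfolding set_mult_def by blast
      have G: "a \<in> carrier G" "b \<in> carrier G" "c \<in> carrier G" "p \<in> carrier G"
        using ab cp CG P'G PG by blast+
      have "inv a \<otimes> c \<in> C"
        using subgroup.m_closed[OF closed_normal_subgroup[OF Cn]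
            subgroup.m_inv_closed[OF closed_normal_subgroup[OF Cn] ab(1)] cp(1)] .
      then have "b \<in> C" using ab(4) G by (simp add: inv_mult_cancel)
      moreover have "inv b \<otimes> a \<otimes> b \<in> P"
        using normal.inv_op_closed1[OF _ G(2) ab(2)] Pn unfolding closed_normal_def by simp
      then have "inv b \<otimes> a \<otimes> b \<otimes> p \<in> P"
        using subgroup.m_closed[OF closed_normal_subgroup[OF Pn] _ cp(2)] by simp
      moreover have "m = b \<otimes> (inv b \<otimes> a \<otimes> b \<otimes> p)"
        using cp ab G by (simp add: m_assoc inv_mult_cancel)
      ultimately show ?thesis using ab by blast
    qed
    then have "supp (C \<inter> P')" using closed_normal_Int[OF Cn P'n] CM unfolding supp_def by blast
    moreover have "C \<inter> P' \<subset> C" using P'(2) by blast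
    ultimately show ?thesis by blast
  qed
  have suppM: "supp M"
  proof -
    have "\<one> \<in> P" using subgroup.one_closed closed_normal_subgroup Pn by blast
    moreover have "m = m \<otimes> \<one>" if "m \<in> M" for m using that MG by auto
    ultimately show ?thesis using M unfolding supp_def by blast
  qed
  obtain C :: "nat \<Rightarrow> 'a set" where C: "\<And>n. supp (C n)" "\<And>n. C (Suc n) \<subset> C n"
    using dependent_nat_choice[of "\<lambda>_. supp" "\<lambda>_ C D. D \<subset> C"] suppM shrink by metis
  have Cn: "closed_normal G T (C n)" for n using C(1) by (auto simp: supp_def)
  note chain = descending_chain[of C, OF Cn C(2)]
  obtain m where m: "m \<in> M" "m \<notin> P" using PM by blast
  have mG: "m \<in> carrier G" using m MG by blast
  \<comment> \<open>\<open>E n\<close> consists of the \<open>c \<in> C n\<close> with \<open>m \<in> c P\<close>; a common point of these sets lies in the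
    trivial intersection of the chain.\<close>
  define E where "E n = C n \<inter> ((\<lambda>p. m \<otimes> inv p) ` P)" for n
  have E_iff: "c \<in> (\<lambda>p. m \<otimes> inv p) ` P \<longleftrightarrow> inv c \<otimes> m \<in> P" if c: "c \<in> carrier G" for c
  proof
    assume "c \<in> (\<lambda>p. m \<otimes> inv p) ` P"
    then obtain p where "p \<in> P" "c = m \<otimes> inv p" by blast
    then show "inv c \<otimes> m \<in> P" using mG PG by (auto simp: inv_mult_group m_assoc)
  next
    assume a: "inv c \<otimes> m \<in> P"
    have "c = m \<otimes> inv (inv c \<otimes> m)" using c mG by (simp add: inv_mult_group inv_mult_cancel)
    then show "c \<in> (\<lambda>p. m \<otimes> inv p) ` P" using a by blast
  qed
  have "closedin T ((\<lambda>p. m \<otimes> inv p) ` P)"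
  proof -
    have "(\<lambda>p. m \<otimes> inv p) ` P \<subseteq> carrier G" using mG PG by auto
    then have "(\<lambda>p. m \<otimes> inv p) ` P = {c \<in> topspace T. inv c \<otimes> m \<in> P}"
      using E_iff topspace_eq by blast
    moreover have "continuous_map T T (\<lambda>c. inv c \<otimes> m)"
      using continuous_map_compose[OF continuous_inv continuous_map_right[OF mG]] by (simp add: o_def)
    ultimately show ?thesis
      using closedin_continuous_map_preimage Pn unfolding closed_normal_def by fastforce
  qed
  then have "closedin T (E n)" for n
    using Cn unfolding E_def closed_normal_def by (intro closedin_Int) auto
  moreover have "E n \<noteq> {}" for n
  proof -
    obtain c p where cp: "c \<in> C n" "p \<in> P" "m = c \<otimes> p" using C(1)[of n] m by (auto simp: supp_def)
    then have "c \<in> carrier G" "p \<in> carrier G"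
      using subgroup.subset[OF closed_normal_subgroup[OF Cn]] PG by auto
    then have "c = m \<otimes> inv p" using cp by (simp add: m_assoc)
    then show ?thesis using cp unfolding E_def by blast
  qed
  moreover have "decseq E" using chain(1) unfolding E_def decseq_def by blast
  ultimately have "(\<Inter>n. E n) \<noteq> {}" using compact_space_imp_nest[OF compact] by blast
  then obtain c where c: "c \<in> E n" for n by blast
  have "c \<in> (\<Inter>n. C n)" using c unfolding E_def by blast
  then have "c = \<one>" using chain(2) by blast
  then have "m \<in> P" using c[of 0] E_iff[of \<one>] mG unfolding E_def by simp
  then show False using m by blast
qed

text \<open>Every proper closed normal subgroup of \<open>M\<close> that is not inside \<open>H\<close> lies in one of the finitely
  many maximal ones, so infinitely many of them would produce, as in Koenig's lemma, a descending
  chain of closed normal subgroups none of which lies in \<open>H\<close>. Its intersection is trivial, and by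
  compactness it contains a point outside \<open>H\<close>.\<close>

theorem finitely_many_closed_normal_not_below:
  assumes H: "openin T H" "\<one> \<in> H"
  shows "finite {N. closed_normal G T N \<and> \<not> N \<subseteq> H}"
proof (rule ccontr)
  assume inf: "infinite {N. closed_normal G T N \<and> \<not> N \<subseteq> H}"
  define bad where "bad M \<longleftrightarrow> closed_normal G T M \<and> infinite {N. closed_normal G T N \<and> \<not> N \<subseteq> H \<and> N \<subseteq> M}" for M
  have step: "\<exists>P. bad P \<and> P \<subset> M" if M: "bad M" for M
  proof (rule ccontr)
    assume no: "\<not> (\<exists>P. bad P \<and> P \<subset> M)"
    have Mn: "closed_normal G T M" using M by (simp add: bad_def)
    define below where "below P = {N. closed_normal G T N \<and> \<not> N \<subseteq> H \<and> N \<subseteq> P}" for P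
    have "below M \<subseteq> insert M (\<Union>P\<in>{P. chief_below P M}. below P)"
    proof
      fix N assume N: "N \<in> below M"
      show "N \<in> insert M (\<Union>P\<in>{P. chief_below P M}. below P)"
      proof (cases "N = M")
        case False
        have "N \<noteq> {\<one>}" using N H unfolding below_def by auto
        then obtain P where "chief_below P M" "N \<subseteq> P"
          using chief_below_exists[of N M] N False unfolding below_def by auto
        then show ?thesis using N unfolding below_def by auto
      qed simp
    qed
    moreover have "finite (below P)" if "chief_below P M" for P
      using no that unfolding bad_def chief_below_def below_def by auto
    then have "finite (insert M (\<Union>P\<in>{P. chief_below P M}. below P))"
      using finite_chief_below[OF Mn] by simp
    ultimately have "finite (below M)" by (rule finite_subset)
    then show False using M by (simp add: bad_def below_def)
  qed
  have "bad (carrier G)"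
  proof -
    have "{N. closed_normal G T N \<and> \<not> N \<subseteq> H} = {N. closed_normal G T N \<and> \<not> N \<subseteq> H \<and> N \<subseteq> carrier G}"
      using subgroup.subset[OF closed_normal_subgroup] by auto
    then show ?thesis using inf closed_normal_carrier unfolding bad_def by simp
  qed
  then obtain C :: "nat \<Rightarrow> 'a set" where C: "\<And>n. bad (C n)" "\<And>n. C (Suc n) \<subset> C n"
    using dependent_nat_choice[of "\<lambda>_. bad" "\<lambda>_ C D. D \<subset> C"] step by metis
  have Cn: "closed_normal G T (C n)" for n using C(1) by (auto simp: bad_def)
  note chain = descending_chain[of C, OF Cn C(2)]
  have "closedin T (C n - H)" for n
    using Cn H unfolding closed_normal_def by (intro closedin_diff) auto
  moreover have "C n - H \<noteq> {}" for n
  proof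
    assume "C n - H = {}"
    then have "{N. closed_normal G T N \<and> \<not> N \<subseteq> H \<and> N \<subseteq> C n} = {}" by blast
    then show False using C(1)[of n] unfolding bad_def by (metis finite.emptyI)
  qed
  moreover have "decseq (\<lambda>n. C n - H)" by (intro decseq_SucI Diff_mono psubset_imp_subset C(2) order_refl)
  ultimately have "(\<Inter>n. C n - H) \<noteq> {}"
    using compact_space_imp_nest[OF compact, of "\<lambda>n. C n - H"] by simp
  then obtain x where x: "\<And>n. x \<in> C n - H" by auto
  then have "x \<in> (\<Inter>n. C n)" by simp
  then show False using chain(2) H x by simp
qed

end

section \<open>Groups isomorphic to a proper open subgroup\<close>

text \<open>Following \<open>f\<close> from any point of \<open>A\<close> leads into \<open>F\<close>, because \<open>w\<close> decreases. Since \<open>f\<close> is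
  injective, points of \<open>A\<close> outside its image reach different points of \<open>F\<close>.\<close>

lemma finite_not_in_image:
  fixes w :: "'b \<Rightarrow> nat"
  assumes fin: "finite F"
    and f: "\<And>x. x \<in> A - F \<Longrightarrow> f x \<in> A" and w: "\<And>x. x \<in> A - F \<Longrightarrow> w (f x) < w x"
    and inj: "inj_on f (A - F)"
  shows "finite (A - f ` (A - F))"
proof -
  have ex: "\<exists>j. (f ^^ j) x \<in> F \<and> (\<forall>i<j. (f ^^ i) x \<in> A - F)" if "x \<in> A" for x
    using that
  proof (induction "w x" arbitrary: x rule: less_induct)
    case less
    show ?case
    proof (cases "x \<in> F")
      case True
      then show ?thesis by (intro exI[of _ 0]) simp
    next
      case False
      then have x: "x \<in> A - F" using less.prems by simp
      then obtain j where j: "(f ^^ j) (f x) \<in> F" "\<forall>i<j. (f ^^ i) (f x) \<in> A - F"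
        using less.hyps[OF w f] by auto
      have "(f ^^ i) x \<in> A - F" if "i < Suc j" for i
        using that x j(2) by (cases i) (auto simp: funpow_swap1)
      then show ?thesis using j(1) by (intro exI[of _ "Suc j"]) (simp add: funpow_swap1)
    qed
  qed
  define s where "s x = (SOME j. (f ^^ j) x \<in> F \<and> (\<forall>i<j. (f ^^ i) x \<in> A - F))" for x
  have s: "(f ^^ s x) x \<in> F" "\<forall>i<s x. (f ^^ i) x \<in> A - F" if "x \<in> A" for x
  proof -
    have "(f ^^ s x) x \<in> F \<and> (\<forall>i<s x. (f ^^ i) x \<in> A - F)"
      unfolding s_def by (rule someI_ex[OF ex[OF that]])
    then show "(f ^^ s x) x \<in> F" "\<forall>i<s x. (f ^^ i) x \<in> A - F" by auto
  qed
  have cancel: "x = (f ^^ (j - i)) y"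
    if "i \<le> j" "\<forall>k<i. (f ^^ k) x \<in> A - F" "\<forall>k<j. (f ^^ k) y \<in> A - F" "(f ^^ i) x = (f ^^ j) y"
    for x y i j
    using that
  proof (induction i arbitrary: j)
    case (Suc i)
    then obtain j' where j': "j = Suc j'" by (cases j) auto
    have "(f ^^ i) x \<in> A - F" "(f ^^ j') y \<in> A - F" using Suc.prems j' by auto
    then have "(f ^^ i) x = (f ^^ j') y" using inj_onD[OF inj] Suc.prems(4) j' by simp
    then show ?case using Suc.IH[of j'] Suc.prems j' by simp
  qed simp
  have le: "x = y"
    if x: "x \<in> A - f ` (A - F)" and y: "y \<in> A - f ` (A - F)" and le: "s x \<le> s y"
      and eq: "(f ^^ s x) x = (f ^^ s y) y" for x y
  proof -
    have xA: "x \<in> A" and yA: "y \<in> A" using x y by auto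
    have *: "x = (f ^^ (s y - s x)) y" using cancel[OF le s(2)[OF xA] s(2)[OF yA] eq] .
    show ?thesis
    proof (cases "s y - s x")
      case 0
      then show ?thesis using * by simp
    next
      case (Suc k)
      then have "(f ^^ k) y \<in> A - F" using s(2)[OF yA] by simp
      then have "x \<in> f ` (A - F)" using * Suc by simp
      then show ?thesis using x by simp
    qed
  qed
  have "inj_on (\<lambda>x. (f ^^ s x) x) (A - f ` (A - F))"
  proof (rule inj_onI)
    fix x y assume "x \<in> A - f ` (A - F)" "y \<in> A - f ` (A - F)" "(f ^^ s x) x = (f ^^ s y) y"
    then show "x = y" using le[of x y] le[of y x] by (cases "s x \<le> s y") auto
  qed
  then show ?thesis
    by (rule inj_on_finite[OF _ _ fin]) (use s(1) in auto)
qed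

context topological_group
begin

text \<open>The normal core of a closed subgroup of finite index is the kernel of the action of \<open>G\<close> on
  the cosets of that subgroup.\<close>

lemma normal_core:
  assumes K: "subgroup K G" "closedin T K" "finite (rcosets K)"
  shows "\<exists>N. closed_normal G T N \<and> N \<subseteq> K \<and> finite (rcosets N)"
proof -
  define N where "N = {x \<in> carrier G. \<forall>g\<in>carrier G. g \<otimes> x \<otimes> inv g \<in> K}"
  have NG: "x \<in> carrier G" if "x \<in> N" for x using that by (simp add: N_def)
  have NI: "g \<otimes> x \<otimes> inv g \<in> K" if "x \<in> N" "g \<in> carrier G" for x g using that by (simp add: N_def)
  have sN: "subgroup N G"
  proof (rule subgroup.intro)
    show "N \<subseteq> carrier G" by (auto simp: N_def)
    show "\<one> \<in> N" using subgroup.one_closed[OF K(1)] by (simp add: N_def)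
    show "x \<otimes> y \<in> N" if x: "x \<in> N" and y: "y \<in> N" for x y
    proof -
      have "g \<otimes> (x \<otimes> y) \<otimes> inv g \<in> K" if g: "g \<in> carrier G" for g
        using subgroup.m_closed[OF K(1) NI[OF x g] NI[OF y g]] NG[OF x] NG[OF y] g
        by (simp add: m_assoc inv_mult_cancel)
      then show ?thesis using NG[OF x] NG[OF y] by (simp add: N_def)
    qed
    show "inv x \<in> N" if x: "x \<in> N" for x
    proof -
      have "g \<otimes> inv x \<otimes> inv g \<in> K" if g: "g \<in> carrier G" for g
        using subgroup.m_inv_closed[OF K(1) NI[OF x g]] NG[OF x] g
        by (simp add: m_assoc inv_mult_group)
      then show ?thesis using NG[OF x] by (simp add: N_def)
    qed
  qed
  have "k \<otimes> x \<otimes> inv k \<in> N" if x: "x \<in> N" and k: "k \<in> carrier G" for x k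
  proof -
    have "g \<otimes> (k \<otimes> x \<otimes> inv k) \<otimes> inv g \<in> K" if g: "g \<in> carrier G" for g
      using NI[OF x m_closed[OF g k]] NG[OF x] g k by (simp add: m_assoc inv_mult_group)
    then show ?thesis using NG[OF x] k by (simp add: N_def)
  qed
  then have nN: "N \<lhd> G" using sN normal_inv_iff by simp
  have "N = (\<Inter>g\<in>carrier G. {x \<in> topspace T. g \<otimes> x \<otimes> inv g \<in> K})"
    unfolding N_def topspace_eq using one_closed by auto
  moreover have "closedin T (\<Inter>g\<in>carrier G. {x \<in> topspace T. g \<otimes> x \<otimes> inv g \<in> K})"
  proof (rule closedin_INT)
    show "carrier G \<noteq> {}" using one_closed by auto
    show "closedin T {x \<in> topspace T. g \<otimes> x \<otimes> inv g \<in> K}" if "g \<in> carrier G" for g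
      using closedin_continuous_map_preimage[OF homeomorphic_imp_continuous_map[OF
            homeomorphic_map_conj[OF that]] K(2)] .
  qed
  ultimately have cN: "closedin T N" by simp
  have NK: "N \<subseteq> K"
  proof
    fix x assume x: "x \<in> N"
    then show "x \<in> K" using NI[OF x one_closed] NG[OF x] by simp
  qed
  have "finite (rcosets N)"
  proof (rule finite_index_by_map(1)[where f = "\<lambda>x. \<lambda>c\<in>rcosets K. c #> x"
        and X = "(rcosets K) \<rightarrow>\<^sub>E (rcosets K)"])
    have "c #> x \<in> rcosets K" if c: "c \<in> rcosets K" and x: "x \<in> carrier G" for c x
    proof -
      obtain a where a: "a \<in> carrier G" "c = K #> a" using c by (auto simp: RCOSETS_def)
      then have "c #> x = K #> (a \<otimes> x)" using x coset_mult_assoc subgroup.subset[OF K(1)] by simp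
      then show ?thesis using a x by (auto simp: RCOSETS_def)
    qed
    then show "(\<lambda>x. \<lambda>c\<in>rcosets K. c #> x) \<in> carrier G \<rightarrow> (rcosets K) \<rightarrow>\<^sub>E (rcosets K)" by auto
    show "finite ((rcosets K) \<rightarrow>\<^sub>E (rcosets K))" using K(3) by (simp add: finite_PiE)
    show "x \<otimes> inv y \<in> N" if x: "x \<in> carrier G" and y: "y \<in> carrier G"
      and eq: "(\<lambda>c\<in>rcosets K. c #> x) = (\<lambda>c\<in>rcosets K. c #> y)" for x y
    proof -
      have "g \<otimes> (x \<otimes> inv y) \<otimes> inv g \<in> K" if g: "g \<in> carrier G" for g
      proof -
        have "K #> g \<in> rcosets K" using g by (auto simp: RCOSETS_def)
        then have "(K #> g) #> x = (K #> g) #> y" using fun_cong[OF eq, of "K #> g"] by simp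
        then have "K #> (g \<otimes> x) = K #> (g \<otimes> y)"
          using coset_mult_assoc subgroup.subset[OF K(1)] g x y by simp
        then have "(g \<otimes> x) \<otimes> inv (g \<otimes> y) \<in> K" using r_coset_eq_iff[OF K(1)] g x y by simp
        then show ?thesis using g x y by (simp add: m_assoc inv_mult_group)
      qed
      then show ?thesis using x y by (simp add: N_def)
    qed
  qed (rule sN)
  then show ?thesis using nN cN NK unfolding closed_normal_def by blast
qed

text \<open>The centralizer of the section \<open>A / B\<close>: its index is bounded in terms of \<open>|A : B|\<close> alone.\<close>

lemma section_centralizer:
  assumes A: "closed_normal G T A" and B: "closed_normal G T B" "finite (rcosets B)" and BA: "B \<subseteq> A"
  defines "C \<equiv> {g \<in> carrier G. \<forall>x\<in>A. g \<otimes> x \<otimes> inv g \<otimes> inv x \<in> B}"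
    and "q \<equiv> card (rcosets\<^bsub>G\<lparr>carrier := A\<rparr>\<^esub> B)"
  shows "closed_normal G T C" and "card (rcosets C) \<le> q ^ q" and "finite (rcosets C)"
proof -
  have nA: "A \<lhd> G" and nB: "B \<lhd> G" and cB: "closedin T B"
    using A B by (auto simp: closed_normal_def)
  have sA: "subgroup A G" and sB: "subgroup B G" using nA nB normal_imp_subgroup by auto
  have AG: "x \<in> carrier G" if "x \<in> A" for x using subgroup.mem_carrier[OF sA that] .
  have BG: "x \<in> carrier G" if "x \<in> B" for x using subgroup.mem_carrier[OF sB that] .
  note cA = normal.inv_op_closed2[OF nA] normal.inv_op_closed1[OF nA]
  note cB' = normal.inv_op_closed2[OF nB] normal.inv_op_closed1[OF nB]
  note simps = m_assoc inv_mult_group inv_mult_cancel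
  have CG: "g \<in> carrier G" if "g \<in> C" for g using that by (simp add: C_def)
  have CD: "g \<otimes> x \<otimes> inv g \<otimes> inv x \<in> B" if "g \<in> C" "x \<in> A" for g x using that by (simp add: C_def)
  have sC: "subgroup C G"
  proof (rule subgroup.intro)
    show "C \<subseteq> carrier G" by (auto simp: C_def)
    show "\<one> \<in> C" using subgroup.one_closed[OF sB] AG by (simp add: C_def)
    show "g \<otimes> h \<in> C" if g: "g \<in> C" and h: "h \<in> C" for g h
    proof -
      have "g \<otimes> h \<otimes> x \<otimes> inv (g \<otimes> h) \<otimes> inv x \<in> B" if x: "x \<in> A" for x
        using subgroup.m_closed[OF sB CD[OF g cA(1)[OF CG[OF h] x]] CD[OF h x]] CG[OF g] CG[OF h] AG[OF x]
        by (simp add: simps)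
      then show ?thesis using CG[OF g] CG[OF h] by (simp add: C_def)
    qed
    show "inv g \<in> C" if g: "g \<in> C" for g
    proof -
      have "inv g \<otimes> x \<otimes> inv (inv g) \<otimes> inv x \<in> B" if x: "x \<in> A" for x
        using subgroup.m_inv_closed[OF sB CD[OF g cA(2)[OF CG[OF g] x]]] CG[OF g] AG[OF x]
        by (simp add: simps)
      then show ?thesis using CG[OF g] by (simp add: C_def)
    qed
  qed
  have "k \<otimes> g \<otimes> inv k \<in> C" if g: "g \<in> C" and k: "k \<in> carrier G" for g k
  proof -
    have "k \<otimes> g \<otimes> inv k \<otimes> x \<otimes> inv (k \<otimes> g \<otimes> inv k) \<otimes> inv x \<in> B" if x: "x \<in> A" for x
      using cB'(1)[OF k CD[OF g cA(2)[OF k x]]] CG[OF g] AG[OF x] k by (simp add: simps)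
    then show ?thesis using CG[OF g] k by (simp add: C_def)
  qed
  then have nC: "C \<lhd> G" using sC normal_inv_iff by simp
  have BC: "B \<subseteq> C"
  proof
    fix b assume b: "b \<in> B"
    have "b \<otimes> x \<otimes> inv b \<otimes> inv x \<in> B" if x: "x \<in> A" for x
      using subgroup.m_closed[OF sB b cB'(1)[OF AG[OF x] subgroup.m_inv_closed[OF sB b]]] AG[OF x] BG[OF b]
      by (simp add: simps)
    then show "b \<in> C" using BG[OF b] by (simp add: C_def)
  qed
  show "closed_normal G T C"
    using closed_overgroup(1)[OF sB cB B(2) sC BC] nC by (simp add: closed_normal_def)
  define Q where "Q = rcosets\<^bsub>G\<lparr>carrier := A\<rparr>\<^esub> B"
  have Q: "Q = {B #> a | a. a \<in> A}" unfolding Q_def by (auto simp: RCOSETS_def)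
  have "Q \<subseteq> rcosets B" unfolding Q using AG by (auto simp: RCOSETS_def)
  then have finQ: "finite Q" using B(2) finite_subset by auto
  define r where "r c = (SOME a. a \<in> A \<and> B #> a = c)" for c
  have r: "r c \<in> A" "B #> r c = c" if "c \<in> Q" for c
  proof -
    have "\<exists>a. a \<in> A \<and> B #> a = c" using that Q by auto
    then have "r c \<in> A \<and> B #> r c = c" unfolding r_def by (rule someI_ex)
    then show "r c \<in> A" "B #> r c = c" by auto
  qed
  define f where "f g = (\<lambda>c\<in>Q. B #> (g \<otimes> r c \<otimes> inv g))" for g
  have "B #> (g \<otimes> r c \<otimes> inv g) \<in> Q" if g: "g \<in> carrier G" and c: "c \<in> Q" for g c
    using cA(1)[OF g r(1)[OF c]] unfolding Q by blast
  then have f: "f \<in> carrier G \<rightarrow> (Q \<rightarrow>\<^sub>E Q)"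
    by (intro Pi_I) (simp add: f_def restrict_PiE_iff)
  \<comment> \<open>If \<open>g\<close> and \<open>h\<close> conjugate every coset representative to the same coset of \<open>B\<close>, they agree on
    all of \<open>A / B\<close>. The element \<open>z\<close> is chosen so that \<open>h\<close> conjugates it to \<open>x\<close>.\<close>
  have sep: "g \<otimes> inv h \<in> C" if g: "g \<in> carrier G" and h: "h \<in> carrier G" and eq: "f g = f h" for g h
  proof -
    have "g \<otimes> inv h \<otimes> x \<otimes> inv (g \<otimes> inv h) \<otimes> inv x \<in> B" if x: "x \<in> A" for x
    proof -
      define z where "z = inv h \<otimes> x \<otimes> h"
      define t where "t = r (B #> z)"
      have z: "z \<in> A" unfolding z_def using cA(2)[OF h x] .
      have zQ: "B #> z \<in> Q" using z Q by auto
      have t: "t \<in> A" "B #> t = B #> z" unfolding t_def using r[OF zQ] by auto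
      have G: "z \<in> carrier G" "t \<in> carrier G" "x \<in> carrier G" using z t x AG by auto
      define n where "n = z \<otimes> inv t"
      have n: "n \<in> B" unfolding n_def using r_coset_eq_iff[OF sB G(1,2)] t(2) by simp
      have "B #> (g \<otimes> t \<otimes> inv g) = B #> (h \<otimes> t \<otimes> inv h)"
        using fun_cong[OF eq, of "B #> z"] zQ unfolding f_def t_def by simp
      then have b: "(g \<otimes> t \<otimes> inv g) \<otimes> inv (h \<otimes> t \<otimes> inv h) \<in> B"
        using r_coset_eq_iff[OF sB] g h G by simp
      have "(g \<otimes> n \<otimes> inv g) \<otimes> ((g \<otimes> t \<otimes> inv g) \<otimes> inv (h \<otimes> t \<otimes> inv h)) \<otimes> inv (h \<otimes> n \<otimes> inv h) \<in> B"
        using subgroup.m_closed[OF sB subgroup.m_closed[OF sB cB'(1)[OF g n] b]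
            subgroup.m_inv_closed[OF sB cB'(1)[OF h n]]] .
      moreover have "h \<otimes> z \<otimes> inv h = x" unfolding z_def using h G by (simp add: simps)
      then have "x = h \<otimes> z \<otimes> inv h" by simp
      moreover have "z = n \<otimes> t" unfolding n_def using G by (simp add: simps)
      ultimately show ?thesis using g h G BG[OF n] by (simp add: simps)
    qed
    then show ?thesis using g h by (simp add: C_def)
  qed
  have finX: "finite (Q \<rightarrow>\<^sub>E Q)" using finQ by (simp add: finite_PiE)
  show "finite (rcosets C)" using finite_index_by_map(1)[OF sC f finX] sep by blast
  have "card (Q \<rightarrow>\<^sub>E Q) = q ^ q" unfolding q_def Q_def[symmetric] using finQ by (simp add: card_PiE)
  then show "card (rcosets C) \<le> q ^ q" using finite_index_by_map(2)[OF sC f finX] sep by simp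
qed

end

context just_infinite_profinite_group
begin

lemma index_pos:
  assumes "closed_normal G T N" "N \<noteq> {\<one>}"
  shows "0 < card (rcosets N)"
proof -
  have "N #> \<one> \<in> rcosets N" by (auto simp: RCOSETS_def)
  then show ?thesis using closed_normal_finite_index[OF assms] card_gt_0_iff by blast
qed

lemma index_mono:
  assumes N: "closed_normal G T N" "N \<noteq> {\<one>}" and M: "subgroup M G" and NM: "N \<subseteq> M"
  shows "card (rcosets M) \<le> card (rcosets N)"
proof -
  have e: "card (rcosets N) = card (rcosets M) * card (rcosets\<^bsub>G\<lparr>carrier := M\<rparr>\<^esub> N)"
    using index_mult[OF closed_normal_subgroup[OF N(1)] M NM] .
  then have "card (rcosets\<^bsub>G\<lparr>carrier := M\<rparr>\<^esub> N) \<noteq> 0" using index_pos[OF N] by auto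
  then show ?thesis using e by simp
qed

lemma finite_bounded_index:
  assumes M: "closed_normal G T M" "M \<noteq> {\<one>}" "b < card (rcosets M)"
  shows "finite {N. closed_normal G T N \<and> N \<noteq> {\<one>} \<and> card (rcosets N) \<le> b}"
proof (rule finite_subset)
  show "finite {N. closed_normal G T N \<and> \<not> N \<subseteq> M}"
    using finitely_many_closed_normal_not_below[OF closed_normal_openin[OF M(1,2)]]
      subgroup.one_closed[OF closed_normal_subgroup[OF M(1)]] by simp
  show "{N. closed_normal G T N \<and> N \<noteq> {\<one>} \<and> card (rcosets N) \<le> b}
      \<subseteq> {N. closed_normal G T N \<and> \<not> N \<subseteq> M}"
  proof
    fix N assume "N \<in> {N. closed_normal G T N \<and> N \<noteq> {\<one>} \<and> card (rcosets N) \<le> b}"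
    then have N: "closed_normal G T N" "N \<noteq> {\<one>}" "card (rcosets N) \<le> b" by auto
    have "\<not> N \<subseteq> M"
    proof
      assume "N \<subseteq> M"
      then have "card (rcosets M) \<le> card (rcosets N)"
        using index_mono[OF N(1,2) closed_normal_subgroup[OF M(1)]] by simp
      then show False using N(3) M(3) by simp
    qed
    then show "N \<in> {N. closed_normal G T N \<and> \<not> N \<subseteq> M}" using N(1) by simp
  qed
qed

end

text \<open>A topological isomorphism \<open>\<phi>\<close> of \<open>G\<close> onto a proper open subgroup \<open>H\<close>.\<close>

locale proper_self_embedding = just_infinite_profinite_group +
  fixes H and \<phi>
  assumes subgroup_H: "subgroup H G" and openin_H: "openin T H" and H_proper: "H \<noteq> carrier G"
    and topological_iso: "topological_iso G T (G\<lparr>carrier := H\<rparr>) (subtopology T H) \<phi>"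
begin

lemma iso: "\<phi> \<in> iso G (G\<lparr>carrier := H\<rparr>)"
  using topological_iso by (simp add: topological_iso_def)

lemma homeo: "homeomorphic_map T (subtopology T H) \<phi>"
  using topological_iso by (simp add: topological_iso_def)

lemma group_H: "group (G\<lparr>carrier := H\<rparr>)"
  using subgroup_imp_group[OF subgroup_H] .

lemma H_carrier: "H \<subseteq> carrier G"
  using subgroup.subset[OF subgroup_H] .

lemma closedin_H: "closedin T H"
  using open_subgroup_closedin[OF subgroup_H openin_H] .

lemma phi_image: "\<phi> ` carrier G = H"
  using iso by (simp add: iso_def bij_betw_def)

lemma phi_inj: "inj_on \<phi> (carrier G)"
  using iso by (simp add: iso_def bij_betw_def)

lemma phi_mem: "x \<in> carrier G \<Longrightarrow> \<phi> x \<in> carrier G"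
  using phi_image H_carrier by blast

lemma phi_hom: "group_hom G G \<phi>"
proof -
  have "\<phi> (x \<otimes> y) = \<phi> x \<otimes> \<phi> y" if "x \<in> carrier G" "y \<in> carrier G" for x y
    using iso that by (simp add: iso_def hom_def)
  then show ?thesis using phi_mem is_group
    by (auto simp: group_hom_def group_hom_axioms_def hom_def)
qed

lemma phi_image_subset: "N \<subseteq> carrier G \<Longrightarrow> \<phi> ` N \<subseteq> H"
  using phi_image by blast

lemma phi_subgroup:
  assumes "subgroup N G"
  shows "subgroup (\<phi> ` N) G"
  using group_hom.subgroup_img_is_subgroup[OF phi_hom assms] .

lemma phi_closedin:
  assumes "closedin T C"
  shows "closedin T (\<phi> ` C)"
proof -
  have "closedin (subtopology T H) (\<phi> ` C)"
    using homeomorphic_map_closedness[OF homeo closedin_subset[OF assms]] assms by simp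
  then show ?thesis using closedin_trans_full closedin_H by blast
qed

lemma index_phi:
  assumes N: "subgroup N G"
  shows "card (rcosets (\<phi> ` N)) = card (rcosets H) * card (rcosets N)"
  using index_mult[OF phi_subgroup[OF N] subgroup_H phi_image_subset[OF subgroup.subset[OF N]]]
    iso_index[OF is_group group_H iso N] by simp

lemma index_H: "2 \<le> card (rcosets H)"
proof -
  have fin: "finite (rcosets H)" using open_subgroup_finite_index[OF subgroup_H openin_H compact] .
  obtain x where x: "x \<in> carrier G" "x \<notin> H" using H_proper H_carrier by blast
  have "H #> \<one> \<noteq> H #> x"
    using r_coset_eq_iff[OF subgroup_H x(1) one_closed] x by auto
  then have "card {H #> \<one>, H #> x} = 2" by simp
  moreover have "{H #> \<one>, H #> x} \<subseteq> rcosets H" using x by (auto simp: RCOSETS_def)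
  ultimately show ?thesis using card_mono[OF fin] by metis
qed

definition nontrivial_normals :: "'a set set" where
  "nontrivial_normals = {N. closed_normal G T N \<and> N \<noteq> {\<one>}}"

lemma nontrivial_normalsD:
  assumes "N \<in> nontrivial_normals"
  shows "closed_normal G T N" "N \<noteq> {\<one>}" "subgroup N G" "N \<subseteq> carrier G"
  using assms closed_normal_subgroup subgroup.subset unfolding nontrivial_normals_def by auto

lemma preimage_normal:
  assumes N: "N \<in> nontrivial_normals" and NH: "N \<subseteq> H"
  defines "P \<equiv> {x \<in> carrier G. \<phi> x \<in> N}"
  shows "\<phi> ` P = N" and "P \<in> nontrivial_normals" and "card (rcosets P) < card (rcosets N)"
proof -
  interpret h: group_hom G G \<phi> by (rule phi_hom)
  have Nn: "N \<lhd> G" "closedin T N" and sN: "subgroup N G"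
    using nontrivial_normalsD[OF N] by (auto simp: closed_normal_def)
  show im: "\<phi> ` P = N" using NH phi_image unfolding P_def by blast
  have sP: "subgroup P G"
    unfolding P_def using subgroup.one_closed[OF sN] subgroup.m_closed[OF sN] subgroup.m_inv_closed[OF sN]
    by (intro subgroup.intro) auto
  have "g \<otimes> x \<otimes> inv g \<in> P" if "x \<in> P" "g \<in> carrier G" for x g
    using normal.inv_op_closed2[OF Nn(1), of "\<phi> g" "\<phi> x"] that unfolding P_def by simp
  then have nP: "P \<lhd> G" using sP normal_inv_iff by simp
  have cont: "continuous_map T T \<phi>"
    using homeomorphic_imp_continuous_map[OF homeo] continuous_map_in_subtopology by blast
  have "closedin T {x \<in> topspace T. \<phi> x \<in> N}"
    using closedin_continuous_map_preimage[OF cont Nn(2)] .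
  then have "closedin T P" by (simp add: P_def topspace_eq)
  moreover have "P \<noteq> {\<one>}"
  proof
    assume "P = {\<one>}"
    then have "N = {\<one>}" using im by auto
    then show False using nontrivial_normalsD(2)[OF N] by simp
  qed
  ultimately show P: "P \<in> nontrivial_normals"
    using nP by (simp add: nontrivial_normals_def closed_normal_def)
  have "0 < card (rcosets P)" using index_pos nontrivial_normalsD[OF P] by simp
  moreover have "card (rcosets N) = card (rcosets H) * card (rcosets P)"
    using index_phi[OF sP] im by simp
  ultimately show "card (rcosets P) < card (rcosets N)" using index_H by simp
qed

text \<open>Taking preimages under \<open>\<phi>\<close> maps the non-trivial closed normal subgroups below \<open>H\<close>, which are
  almost all of them, injectively back into the non-trivial closed normal subgroups of \<open>G\<close>.\<close>

lemma finite_image_not_normal: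
  "finite {N \<in> nontrivial_normals. \<phi> ` N \<notin> nontrivial_normals}"
proof -
  define F where "F = {N \<in> nontrivial_normals. \<not> N \<subseteq> H}"
  define f where "f N = {x \<in> carrier G. \<phi> x \<in> N}" for N
  have NF: "N \<in> nontrivial_normals" "N \<subseteq> H" if "N \<in> nontrivial_normals - F" for N
    using that by (auto simp: F_def)
  have "finite (nontrivial_normals - f ` (nontrivial_normals - F))"
  proof (rule finite_not_in_image[where w = "\<lambda>N. card (rcosets N)"])
    have "finite {N. closed_normal G T N \<and> \<not> N \<subseteq> H}"
      using finitely_many_closed_normal_not_below[OF openin_H subgroup.one_closed[OF subgroup_H]] .
    then show "finite F" by (rule rev_finite_subset) (auto simp: F_def nontrivial_normals_def)
    show "f N \<in> nontrivial_normals" if "N \<in> nontrivial_normals - F" for N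
      using preimage_normal(2)[OF NF[OF that]] by (simp add: f_def)
    show "card (rcosets (f N)) < card (rcosets N)" if "N \<in> nontrivial_normals - F" for N
      using preimage_normal(3)[OF NF[OF that]] by (simp add: f_def)
    show "inj_on f (nontrivial_normals - F)"
    proof (rule inj_on_inverseI)
      show "\<phi> ` f N = N" if "N \<in> nontrivial_normals - F" for N
        using preimage_normal(1)[OF NF[OF that]] by (simp add: f_def)
    qed
  qed
  moreover have "{N \<in> nontrivial_normals. \<phi> ` N \<notin> nontrivial_normals} \<subseteq>
      nontrivial_normals - f ` (nontrivial_normals - F)"
  proof
    fix N assume N: "N \<in> {N \<in> nontrivial_normals. \<phi> ` N \<notin> nontrivial_normals}"
    have "N \<noteq> f M" if M: "M \<in> nontrivial_normals - F" for M
    proof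
      assume "N = f M"
      then have "\<phi> ` N = M" using preimage_normal(1)[OF NF[OF M]] by (simp add: f_def)
      then show False using N M by simp
    qed
    then show "N \<in> nontrivial_normals - f ` (nontrivial_normals - F)" using N by blast
  qed
  ultimately show ?thesis by (rule rev_finite_subset)
qed

text \<open>The normal cores of the images \<open>\<phi>\<^sup>b(G)\<close> have unbounded index.\<close>

lemma large_index_exists: "\<exists>N \<in> nontrivial_normals. b \<le> card (rcosets N)"
proof -
  have "\<exists>S. subgroup S G \<and> closedin T S \<and> b < card (rcosets S)"
  proof (induction b)
    case 0
    have "rcosets (carrier G) = {carrier G}"
      using coset_join2[OF _ subgroup_self] one_closed by (auto simp: RCOSETS_def)
    then show ?case using subgroup_self closedin_topspace[of T] topspace_eq
      by (intro exI[of _ "carrier G"]) simp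
  next
    case (Suc b)
    then obtain S where S: "subgroup S G" "closedin T S" "b < card (rcosets S)" by blast
    have "Suc b < 2 * card (rcosets S)" using S(3) by simp
    also have "\<dots> \<le> card (rcosets (\<phi> ` S))" using index_phi[OF S(1)] index_H by simp
    finally show ?case using phi_subgroup[OF S(1)] phi_closedin[OF S(2)] by blast
  qed
  then obtain S where S: "subgroup S G" "closedin T S" "b < card (rcosets S)" by blast
  have "finite (rcosets S)" by (rule card_ge_0_finite) (use S(3) in simp)
  then obtain N where N: "closed_normal G T N" "N \<subseteq> S" "finite (rcosets N)"
    using normal_core S by blast
  have "N \<noteq> {\<one>}" using finite_index_nontrivial[OF N(3)] .
  then show ?thesis using index_mono[OF N(1) _ S(1) N(2)] S(3) N(1)
    by (intro bexI[of _ N]) (auto simp: nontrivial_normals_def)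
qed

text \<open>The subgroups in the finite exceptional set have bounded index, and \<open>\<phi>\<close> increases indices.\<close>

lemma all_iterates_normal:
  "\<exists>N. \<forall>i. (\<phi> ^^ i) ` N \<in> nontrivial_normals"
proof -
  let ?E = "{N \<in> nontrivial_normals. \<phi> ` N \<notin> nontrivial_normals}"
  obtain b where b: "\<And>N. N \<in> ?E \<Longrightarrow> card (rcosets N) < b"
    using finite_nat_set_iff_bounded[of "(\<lambda>N. card (rcosets N)) ` ?E"] finite_image_not_normal by auto
  obtain N where N: "N \<in> nontrivial_normals" "b \<le> card (rcosets N)"
    using large_index_exists by blast
  have "(\<phi> ^^ i) ` N \<in> nontrivial_normals \<and> b \<le> card (rcosets ((\<phi> ^^ i) ` N))" for i
  proof (induction i)
    case (Suc i)
    let ?M = "(\<phi> ^^ i) ` N"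
    have eq: "(\<phi> ^^ Suc i) ` N = \<phi> ` ?M" by (simp add: image_comp)
    have "?M \<notin> ?E" using b[of ?M] Suc by linarith
    then have "\<phi> ` ?M \<in> nontrivial_normals" using Suc by blast
    moreover have "card (rcosets ?M) \<le> card (rcosets (\<phi> ` ?M))"
      using index_phi[of ?M] index_H nontrivial_normalsD(3) Suc by simp
    ultimately show ?case using Suc unfolding eq by simp
  qed (use N in simp)
  then show ?thesis by blast
qed

text \<open>If \<open>x\<close> and \<open>y\<close> in \<open>N\<close> did not commute, their commutator would lie outside some
  \<open>\<phi>\<^sup>m(N) \<subseteq> N\<close>. The sections \<open>\<phi>\<^sup>i(N) / \<phi>\<^sup>i\<^sup>+\<^sup>m(N)\<close> all have the same finite order, so only finitely
  many subgroups of \<open>G\<close> occur as their centralizers, and some \<open>\<phi>\<^sup>k(N)\<close> lies in all of these.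
  Then \<open>\<phi>\<^sup>k(N) / \<phi>\<^sup>k\<^sup>+\<^sup>m(N)\<close> is abelian, and so is its isomorphic copy \<open>N / \<phi>\<^sup>m(N)\<close>.\<close>

lemma iterates_normal_imp_abelian:
  assumes N: "\<And>i. (\<phi> ^^ i) ` N \<in> nontrivial_normals" and xy: "x \<in> N" "y \<in> N"
  shows "x \<otimes> y = y \<otimes> x"
proof (rule ccontr)
  assume nc: "x \<otimes> y \<noteq> y \<otimes> x"
  define M where "M i = (\<phi> ^^ i) ` N" for i
  note M = nontrivial_normalsD[OF N, folded M_def]
  have M0: "M 0 = N" by (simp add: M_def)
  have MSuc: "M (Suc i) = \<phi> ` M i" for i by (simp add: M_def image_comp)
  have Madd: "M (i + j) = (\<phi> ^^ i) ` M j" for i j by (simp add: M_def funpow_add image_comp)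
  define d where "d = card (rcosets H)"
  have iM: "card (rcosets (M i)) = d ^ i * card (rcosets N)" for i
    by (induction i) (simp_all add: M0 MSuc index_phi[OF M(3)] d_def)
  have posN: "0 < card (rcosets N)" using index_pos[OF M(1,2)[of 0]] M0 by simp
  have i_lt: "i < card (rcosets (M i))" for i
  proof -
    have "i < d ^ i" using index_H less_exp[of i] power_mono[of 2 d i] unfolding d_def by linarith
    also have "\<dots> \<le> card (rcosets (M i))" using posN iM by simp
    finally show ?thesis .
  qed
  have "inj M"
  proof (rule injI)
    fix i j assume "M i = M j"
    then have "d ^ i * card (rcosets N) = d ^ j * card (rcosets N)" using iM by metis
    then have "d ^ i = d ^ j" using posN by simp
    moreover have "1 < d" using index_H d_def by simp
    ultimately show "i = j" by simp
  qed
  then have infM: "infinite (range M)" using range_inj_infinite by blast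
  have below: "\<exists>k. M k \<subseteq> L" if L: "openin T L" "\<one> \<in> L" for L
  proof (rule ccontr)
    assume "\<nexists>k. M k \<subseteq> L"
    then have "range M \<subseteq> {N. closed_normal G T N \<and> \<not> N \<subseteq> L}" using M(1) by blast
    then show False using finitely_many_closed_normal_not_below[OF L] infM finite_subset by blast
  qed
  have one: "\<one> \<in> M i" for i using subgroup.one_closed[OF M(3)] .
  have G: "x \<in> carrier G" "y \<in> carrier G" using xy M(4)[of 0] M0 by auto
  define c where "c = x \<otimes> y \<otimes> inv x \<otimes> inv y"
  have cG: "c \<in> carrier G" using G by (simp add: c_def)
  have "c \<noteq> \<one>"
  proof
    assume "c = \<one>"
    then have "c \<otimes> (y \<otimes> x) = y \<otimes> x" using G by simp
    moreover have "c \<otimes> (y \<otimes> x) = x \<otimes> y" using G by (simp add: c_def m_assoc inv_mult_cancel)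
    ultimately show False using nc by simp
  qed
  moreover have "(\<Inter>i. M i) = {\<one>}"
    using infinite_family_Inter_trivial[OF infM] M(1) by blast
  ultimately obtain j where j: "c \<notin> M j" by blast
  obtain m where m: "M m \<subseteq> M j \<inter> N"
    using below[of "M j \<inter> N"] closed_normal_openin[OF M(1,2)] openin_Int one M0 by (metis IntI)
  define C where "C i = {g \<in> carrier G. \<forall>x\<in>M i. g \<otimes> x \<otimes> inv g \<otimes> inv x \<in> M (i + m)}" for i
  have MM: "M (i + m) \<subseteq> M i" for i using Madd[of i m] Madd[of i 0] m M0 by auto
  define q where "q = card (rcosets (M m))"
  have fin: "finite (rcosets (M i))" for i using closed_normal_finite_index[OF M(1,2)] .
  have C: "closed_normal G T (C i)" "C i \<noteq> {\<one>}" "card (rcosets (C i)) \<le> q ^ q" for i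
  proof -
    let ?q = "card (rcosets\<^bsub>G\<lparr>carrier := M i\<rparr>\<^esub> (M (i + m)))"
    note sc = section_centralizer[OF M(1) M(1) fin MM, of i, folded C_def]
    show "closed_normal G T (C i)" "C i \<noteq> {\<one>}" using sc(1) finite_index_nontrivial[OF sc(3)] by auto
    have "card (rcosets (M (i + m))) = card (rcosets (M i)) * ?q"
      using index_mult[OF M(3) M(3) MM] .
    then have "d ^ i * (d ^ m * card (rcosets N)) = d ^ i * (card (rcosets N) * ?q)"
      by (simp add: iM power_add mult.assoc)
    then have "q = card (rcosets N) * ?q" using index_H by (simp add: q_def iM d_def)
    then have "?q \<le> q" using posN by simp
    moreover have "0 < q" using i_lt[of m] by (simp add: q_def)
    ultimately have "?q ^ ?q \<le> q ^ q"
      using power_mono[of ?q q ?q] power_increasing[of ?q q q] by simp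
    then show "card (rcosets (C i)) \<le> q ^ q" using sc(2) by simp
  qed
  have "finite (range C)"
  proof (rule finite_subset)
    show "range C \<subseteq> {N. closed_normal G T N \<and> N \<noteq> {\<one>} \<and> card (rcosets N) \<le> q ^ q}" using C by blast
    show "finite {N. closed_normal G T N \<and> N \<noteq> {\<one>} \<and> card (rcosets N) \<le> q ^ q}"
      using finite_bounded_index[OF M(1,2) i_lt] .
  qed
  then have "openin T (\<Inter>(range C))"
    using closed_normal_openin[OF C(1,2)] by (intro openin_Inter) auto
  moreover have "\<one> \<in> \<Inter>(range C)" using subgroup.one_closed[OF closed_normal_subgroup[OF C(1)]] by blast
  ultimately obtain k where k: "M k \<subseteq> \<Inter>(range C)" using below by blast
  let ?p = "\<phi> ^^ k"
  have p: "group_hom G G ?p \<and> inj_on ?p (carrier G)"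
  proof (induction k)
    case 0
    show ?case using is_group by (auto simp: group_hom_def group_hom_axioms_def hom_def)
  next
    case (Suc k)
    interpret h: group_hom G G "\<phi> ^^ k" using Suc by simp
    have "\<phi> ^^ Suc k \<in> hom G G"
      using phi_hom h.homh by (simp add: hom_def group_hom_def group_hom_axioms_def Pi_def)
    moreover have "inj_on (\<phi> ^^ Suc k) (carrier G)"
      using Suc comp_inj_on[of "\<phi> ^^ k" "carrier G" \<phi>] inj_on_subset[OF phi_inj] h.hom_closed
      by (simp add: image_subset_iff)
    ultimately show ?case using is_group by (simp add: group_hom_def group_hom_axioms_def comp_def)
  qed
  then interpret p: group_hom G G ?p by simp
  have "?p x \<in> C k" "?p y \<in> M k" using k xy by (auto simp: M_def)
  then have "?p x \<otimes> ?p y \<otimes> inv (?p x) \<otimes> inv (?p y) \<in> M (k + m)" by (simp add: C_def)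
  moreover have "?p x \<otimes> ?p y \<otimes> inv (?p x) \<otimes> inv (?p y) = ?p c" using G by (simp add: c_def)
  ultimately have "?p c \<in> ?p ` M m" using Madd by simp
  then have "c \<in> M m" using inj_on_image_mem_iff[of ?p "carrier G" c "M m"] p cG M(4) by blast
  then show False using m j by blast
qed

theorem virtually_abelian: "virtually_abelian G T"
proof -
  obtain N where N: "\<And>i. (\<phi> ^^ i) ` N \<in> nontrivial_normals" using all_iterates_normal by blast
  then have "N \<in> nontrivial_normals" using N[of 0] by simp
  note Nn = nontrivial_normalsD[OF this]
  have "comm_group (G\<lparr>carrier := N\<rparr>)"
    using group.group_comm_groupI[OF subgroup_imp_group[OF Nn(3)]] iterates_normal_imp_abelian[OF N]
    by simp
  then show ?thesis
    unfolding virtually_abelian_def closed_subgroup_def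
    using Nn closed_normal_finite_index by (intro exI[of _ N]) (auto simp: closed_normal_def)
qed

end

section \<open>Radicals\<close>

lemma closed_subnormal_image:
  assumes S: "closed_subnormal A U S" and f: "topological_iso A U B V f"
    and A: "group A" and B: "group B"
    and U: "topspace U = carrier A" and V: "topspace V = carrier B"
  shows "subgroup S A \<and> closedin U S \<and> closed_subnormal B V (f ` S)"
  using S
proof induction
  case whole
  have "f ` carrier A = carrier B" using f by (simp add: topological_iso_def iso_def bij_betw_def)
  then show ?case
    using closed_subnormal.whole[of B V] group.subgroup_self[OF A] closedin_topspace[of U] U by simp
next
  case (step K S)
  have K: "subgroup K A" "closed_subnormal B V (f ` K)" using step.IH by auto
  have SK: "subgroup S (A\<lparr>carrier := K\<rparr>)" using normal_imp_subgroup[OF step.hyps(2)] .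
  have SA: "subgroup S A" using group.incl_subgroup[OF A K(1) SK] .
  have fK: "subgroup (f ` K) B"
  proof -
    have "group_hom A B f" using f A B
      by (simp add: group_hom_def group_hom_axioms_def topological_iso_def iso_def)
    then show ?thesis using group_hom.subgroup_img_is_subgroup K(1) by blast
  qed
  have "f \<in> iso (A\<lparr>carrier := K\<rparr>) (B\<lparr>carrier := f ` K\<rparr>)"
    using topological_iso_restrict[OF f subgroup.subset[OF K(1)] U V] by (simp add: topological_iso_def)
  then have "f ` S \<lhd> B\<lparr>carrier := f ` K\<rparr>"
    using iso_normal_subgroup[OF _ _ _ step.hyps(2)] group.subgroup_imp_group[OF A K(1)]
      group.subgroup_imp_group[OF B fK] by blast
  moreover have "closedin V (f ` S)"
    using f homeomorphic_map_closedness[of U V f S] closedin_subset[OF step.hyps(3)] step.hyps(3)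
    by (simp add: topological_iso_def)
  ultimately show ?case using closed_subnormal.step[OF K(2)] SA step.hyps(3) by blast
qed

lemma subtopology_nested: "S \<subseteq> P \<Longrightarrow> subtopology (subtopology T P) S = subtopology T S"
  by (simp add: subtopology_subtopology Int_absorb1)

context topological_group
begin

lemma topspace_restrict: "subgroup S G \<Longrightarrow> topspace (subtopology T S) = carrier (G\<lparr>carrier := S\<rparr>)"
  using subgroup.subset[of S G] topspace_eq by (auto simp: topspace_subtopology)

lemma closed_subnormal_closed_subgroup:
  assumes "closed_subnormal G T S"
  shows "subgroup S G" "closedin T S"
proof -
  have "id \<in> iso G G" by (simp add: iso_set_refl id_def)
  then have "topological_iso G T G T id"
    by (simp add: topological_iso_def homeomorphic_map_id)
  then show "subgroup S G" "closedin T S"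
    using closed_subnormal_image[OF assms _ is_group is_group topspace_eq topspace_eq] by auto
qed

lemma closed_subnormal_trans:
  assumes Q: "closed_subnormal G T Q"
    and S: "closed_subnormal (G\<lparr>carrier := Q\<rparr>) (subtopology T Q) S"
  shows "closed_subnormal G T S"
  using S
proof induction
  case whole
  then show ?case using Q by simp
next
  case (step K S)
  have "closedin T S"
    using closedin_trans_full[OF step.hyps(3)] closed_subnormal_closed_subgroup(2)[OF Q] by simp
  then show ?case using closed_subnormal.step[OF step.IH, of S] step.hyps(2) by simp
qed

lemma closed_subnormal_Int:
  assumes S: "closed_subnormal G T S" and R: "subgroup R G"
  shows "closed_subnormal (G\<lparr>carrier := R\<rparr>) (subtopology T R) (S \<inter> R)"
  using S
proof induction
  case whole
  have "carrier G \<inter> R = carrier (G\<lparr>carrier := R\<rparr>)" using subgroup.subset[OF R] by auto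
  then show ?case using closed_subnormal.whole[of "G\<lparr>carrier := R\<rparr>"] by simp
next
  case (step K S)
  have K: "subgroup K G" using closed_subnormal_closed_subgroup(1)[OF step.hyps(1)] .
  have KR: "subgroup (K \<inter> R) G" using subgroups_Inter_pair[OF K R] .
  have SK: "subgroup S (G\<lparr>carrier := K\<rparr>)" using normal_imp_subgroup[OF step.hyps(2)] .
  have SG: "subgroup S G" using incl_subgroup[OF K SK] .
  have sub: "S \<inter> R \<subseteq> K \<inter> R" using subgroup.subset[OF SK] by auto
  have "x \<otimes> h \<otimes> inv x \<in> S \<inter> R" if x: "x \<in> K \<inter> R" and h: "h \<in> S \<inter> R" for x h
  proof
    show "x \<otimes> h \<otimes> inv x \<in> S"
      using normal.inv_op_closed2[OF step.hyps(2), of x h] x h m_inv_consistent[OF K, of x] by simp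
    show "x \<otimes> h \<otimes> inv x \<in> R"
      using x h by (intro subgroup.m_closed[OF R] subgroup.m_inv_closed[OF R]) auto
  qed
  then have "S \<inter> R \<lhd> G\<lparr>carrier := K \<inter> R\<rparr>"
    using group.normal_inv_iff[OF subgroup_imp_group[OF KR]] m_inv_consistent[OF KR]
      subgroup_incl[OF subgroups_Inter_pair[OF SG R] KR sub] by simp
  moreover have "closedin (subtopology T R) (S \<inter> R)"
    using step.hyps(3) closedin_subtopology by blast
  ultimately show ?case using closed_subnormal.step[OF step.IH, of "S \<inter> R"] by simp
qed

lemma closure_of_subgroup:
  assumes S: "subgroup S G"
  shows "subgroup (T closure_of S) G"
proof (rule subgroup.intro)
  have SG: "S \<subseteq> topspace T" using subgroup.subset[OF S] topspace_eq by simp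
  show "T closure_of S \<subseteq> carrier G" using closure_of_subset_topspace[of T S] topspace_eq by simp
  show "\<one> \<in> T closure_of S" using closure_of_subset[OF SG] subgroup.one_closed[OF S] by blast
  show "inv x \<in> T closure_of S" if x: "x \<in> T closure_of S" for x
  proof -
    have "(\<lambda>x. inv x) ` (T closure_of S) \<subseteq> T closure_of ((\<lambda>x. inv x) ` S)"
      using continuous_map_image_closure_subset[OF continuous_inv] .
    also have "\<dots> \<subseteq> T closure_of S"
      using subgroup.m_inv_closed[OF S] by (intro closure_of_mono) auto
    finally show ?thesis using x by blast
  qed
  show "x \<otimes> y \<in> T closure_of S" if x: "x \<in> T closure_of S" and y: "y \<in> T closure_of S" for x y
  proof -
    have "(\<lambda>(x, y). x \<otimes> y) ` ((prod_topology T T) closure_of (S \<times> S)) \<subseteq>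
        T closure_of ((\<lambda>(x, y). x \<otimes> y) ` (S \<times> S))"
      using continuous_map_image_closure_subset[OF continuous_mult] .
    also have "\<dots> \<subseteq> T closure_of S"
      using subgroup.m_closed[OF S] by (intro closure_of_mono) auto
    finally have "(\<lambda>(x, y). x \<otimes> y) (x, y) \<in> T closure_of S"
      using x y unfolding closure_of_Times by blast
    then show ?thesis by simp
  qed
qed

end

lemma (in profinite_group) closed_subgroup_profinite:
  assumes S: "subgroup S G" "closedin T S"
  shows "profinite_group (G\<lparr>carrier := S\<rparr>) (subtopology T S)"
proof -
  interpret S: group "G\<lparr>carrier := S\<rparr>" using subgroup_imp_group[OF S(1)] .
  have "continuous_map (subtopology (prod_topology T T) (S \<times> S)) (subtopology T S) (\<lambda>(x, y). x \<otimes> y)"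
    using continuous_map_from_subtopology[OF continuous_mult] subgroup.m_closed[OF S(1)]
    by (intro continuous_map_into_subtopology) auto
  then have mult: "continuous_map (prod_topology (subtopology T S) (subtopology T S)) (subtopology T S)
      (\<lambda>(x, y). x \<otimes>\<^bsub>G\<lparr>carrier := S\<rparr>\<^esub> y)"
    by (simp add: subtopology_Times)
  have "continuous_map (subtopology T S) (subtopology T S) (\<lambda>x. inv x)"
    using continuous_map_from_subtopology[OF continuous_inv] subgroup.m_inv_closed[OF S(1)]
    by (intro continuous_map_into_subtopology) auto
  then have inv: "continuous_map (subtopology T S) (subtopology T S) (\<lambda>x. inv\<^bsub>G\<lparr>carrier := S\<rparr>\<^esub> x)"
    using m_inv_consistent[OF S(1)] topspace_restrict[OF S(1)]
    by (elim continuous_map_eq) simp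
  have "totally_disconnected_space (subtopology T S)"
    using totally_disconnected by (simp add: totally_disconnected_space_def connectedin_subtopology)
  moreover have "compact_space (subtopology T S)"
    using closedin_compact_space[OF compact S(2)] by (simp add: compact_space_subtopology)
  moreover have "Hausdorff_space (subtopology T S)" using Hausdorff Hausdorff_space_subtopology by blast
  ultimately show ?thesis
    using mult inv topspace_restrict[OF S(1)] by unfold_locales auto
qed

text \<open>Radicals are defined for groups without extra record fields.\<close>

locale monoid_profinite_group = profinite_group G T
  for G :: "'a monoid" (structure) and T :: "'a topology"
begin

lemma subnormal_member_image:
  assumes X: "profinite_class \<X>" and f: "topological_iso (G\<lparr>carrier := P\<rparr>) (subtopology T P)
      (G\<lparr>carrier := Q\<rparr>) (subtopology T Q) f"
    and P: "subgroup P G" and Q: "closed_subnormal G T Q"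
    and S: "closed_subnormal G T S" "S \<subseteq> P" "(G\<lparr>carrier := S\<rparr>, subtopology T S) \<in> \<X>"
  shows "closed_subnormal G T (f ` S)"
    and "(G\<lparr>carrier := f ` S\<rparr>, subtopology T (f ` S)) \<in> \<X>"
proof -
  have sQ: "subgroup Q G" using closed_subnormal_closed_subgroup(1)[OF Q] .
  note tops = topspace_restrict[OF P] topspace_restrict[OF sQ]
  have "closed_subnormal (G\<lparr>carrier := P\<rparr>) (subtopology T P) S"
    using closed_subnormal_Int[OF S(1) P] S(2) by (simp add: Int_absorb2)
  then have "closed_subnormal (G\<lparr>carrier := Q\<rparr>) (subtopology T Q) (f ` S)"
    using closed_subnormal_image[OF _ f subgroup_imp_group[OF P] subgroup_imp_group[OF sQ] tops] by blast
  then show sub: "closed_subnormal G T (f ` S)" using closed_subnormal_trans[OF Q] by blast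
  have fS: "f ` S \<subseteq> Q"
    using f S(2) by (auto simp: topological_iso_def iso_def bij_betw_def)
  have "topological_iso (G\<lparr>carrier := S\<rparr>) (subtopology T S) (G\<lparr>carrier := f ` S\<rparr>) (subtopology T (f ` S)) f"
    using topological_iso_restrict[OF f _ tops, of S] S(2) fS by (simp add: subtopology_nested)
  then have "top_isomorphic (G\<lparr>carrier := S\<rparr>) (subtopology T S) (G\<lparr>carrier := f ` S\<rparr>) (subtopology T (f ` S))"
    using top_isomorphic_iff by blast
  moreover have "profinite_group (G\<lparr>carrier := f ` S\<rparr>) (subtopology T (f ` S))"
    using closed_subgroup_profinite closed_subnormal_closed_subgroup[OF sub] by blast
  ultimately show "(G\<lparr>carrier := f ` S\<rparr>, subtopology T (f ` S)) \<in> \<X>"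
    using X S(3) unfolding profinite_class_def by blast
qed

lemma class_radical_subgroup:
  shows "subgroup (class_radical \<X> G T) G" and "closedin T (class_radical \<X> G T)"
proof -
  have "\<Union>{S. closed_subnormal G T S \<and> (G\<lparr>carrier := S\<rparr>, subtopology T S) \<in> \<X>} \<subseteq> carrier G"
    using subgroup.subset[OF closed_subnormal_closed_subgroup(1)] by auto
  then show "subgroup (class_radical \<X> G T) G"
    unfolding class_radical_def by (intro closure_of_subgroup generate_is_subgroup)
  show "closedin T (class_radical \<X> G T)" unfolding class_radical_def by simp
qed

lemma member_le_class_radical:
  assumes S: "closed_subnormal G T S" "(G\<lparr>carrier := S\<rparr>, subtopology T S) \<in> \<X>"
  shows "S \<subseteq> class_radical \<X> G T"
proof -
  let ?A = "\<Union>{S. closed_subnormal G T S \<and> (G\<lparr>carrier := S\<rparr>, subtopology T S) \<in> \<X>}"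
  have "?A \<subseteq> carrier G"
    using subgroup.subset[OF closed_subnormal_closed_subgroup(1)] by auto
  then have "generate G ?A \<subseteq> topspace T"
    using generate_incl topspace_eq by blast
  then have "generate G ?A \<subseteq> class_radical \<X> G T"
    unfolding class_radical_def by (rule closure_of_subset)
  moreover have "S \<subseteq> generate G ?A" using S generate.incl[of _ ?A G] by blast
  ultimately show ?thesis by blast
qed

lemma class_radical_least:
  assumes L: "subgroup L G" "closedin T L"
    and S: "\<And>S. closed_subnormal G T S \<Longrightarrow> (G\<lparr>carrier := S\<rparr>, subtopology T S) \<in> \<X> \<Longrightarrow> S \<subseteq> L"
  shows "class_radical \<X> G T \<subseteq> L"
  unfolding class_radical_def
proof (rule closure_of_minimal[OF _ L(2)])
  show "generate G (\<Union>{S. closed_subnormal G T S \<and> (G\<lparr>carrier := S\<rparr>, subtopology T S) \<in> \<X>}) \<subseteq> L"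
    by (rule generate_subgroup_incl[OF _ L(1)]) (use S in blast)
qed

text \<open>Applied with \<open>P\<close> the whole group, this makes the radical characteristic; applied with \<open>P\<close>
  the radical itself, it shows that the radical contains every subnormal subgroup isomorphic to it.\<close>

lemma image_class_radical_subset:
  assumes X: "profinite_class \<X>" and f: "topological_iso (G\<lparr>carrier := P\<rparr>) (subtopology T P)
      (G\<lparr>carrier := Q\<rparr>) (subtopology T Q) f"
    and P: "subgroup P G" "closedin T P" and Q: "closed_subnormal G T Q"
    and RP: "class_radical \<X> G T \<subseteq> P"
  shows "f ` class_radical \<X> G T \<subseteq> class_radical \<X> G T"
proof -
  let ?R = "class_radical \<X> G T"
  have sQ: "subgroup Q G" using closed_subnormal_closed_subgroup(1)[OF Q] .
  have fh: "group_hom (G\<lparr>carrier := P\<rparr>) (G\<lparr>carrier := Q\<rparr>) f"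
    using f subgroup_imp_group[OF P(1)] subgroup_imp_group[OF sQ]
    by (simp add: topological_iso_def iso_def group_hom_def group_hom_axioms_def)
  interpret f: group_hom "G\<lparr>carrier := P\<rparr>" "G\<lparr>carrier := Q\<rparr>" f by (rule fh)
  define L where "L = {x \<in> P. f x \<in> ?R}"
  have "subgroup L G"
  proof (rule subgroup.intro)
    show "L \<subseteq> carrier G" using subgroup.subset[OF P(1)] by (auto simp: L_def)
    show "\<one> \<in> L"
      using f.hom_one subgroup.one_closed[OF P(1)] subgroup.one_closed[OF class_radical_subgroup(1)]
      by (simp add: L_def)
    show "x \<otimes> y \<in> L" if "x \<in> L" "y \<in> L" for x y
      using that f.hom_mult[of x y] subgroup.m_closed[OF P(1)]
        subgroup.m_closed[OF class_radical_subgroup(1)] by (simp add: L_def)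
    show "inv x \<in> L" if x: "x \<in> L" for x
    proof -
      have "f x \<in> Q" using f.hom_closed[of x] x by (simp add: L_def)
      then have "f (inv x) = inv (f x)"
        using f.hom_inv[of x] x m_inv_consistent[OF P(1)] m_inv_consistent[OF sQ] by (simp add: L_def)
      then show ?thesis
        using x subgroup.m_inv_closed[OF P(1)] subgroup.m_inv_closed[OF class_radical_subgroup(1)]
        by (simp add: L_def)
    qed
  qed
  moreover have "closedin T L"
  proof -
    have "continuous_map (subtopology T P) T f"
      using f homeomorphic_imp_continuous_map continuous_map_in_subtopology
      unfolding topological_iso_def by blast
    then have "closedin (subtopology T P) {x \<in> topspace (subtopology T P). f x \<in> ?R}"
      using closedin_continuous_map_preimage[OF _ class_radical_subgroup(2)] by blast
    then have "closedin (subtopology T P) L"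
      using topspace_restrict[OF P(1)] by (simp add: L_def del: topspace_subtopology)
    then show ?thesis using closedin_trans_full P(2) by blast
  qed
  moreover have "S \<subseteq> L" if S: "closed_subnormal G T S" "(G\<lparr>carrier := S\<rparr>, subtopology T S) \<in> \<X>" for S
  proof -
    have SP: "S \<subseteq> P" using member_le_class_radical[OF S] RP by blast
    have "f ` S \<subseteq> ?R"
      using member_le_class_radical subnormal_member_image[OF X f P(1) Q S(1) SP S(2)] by blast
    then show ?thesis using SP by (auto simp: L_def)
  qed
  ultimately have "?R \<subseteq> L" using class_radical_least by blast
  then show ?thesis by (auto simp: L_def)
qed

lemma class_radical_closed_normal:
  assumes X: "profinite_class \<X>"
  shows "closed_normal G T (class_radical \<X> G T)"
proof -
  let ?R = "class_radical \<X> G T"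
  have "g \<otimes> x \<otimes> inv g \<in> ?R" if x: "x \<in> ?R" and g: "g \<in> carrier G" for x g
  proof -
    let ?c = "\<lambda>x. g \<otimes> x \<otimes> inv g"
    have "?c \<in> iso G G"
    proof (rule isoI)
      show "?c \<in> hom G G" using g by (simp add: hom_def m_assoc inv_mult_cancel)
      show "bij_betw ?c (carrier G) (carrier G)"
        by (rule bij_betw_byWitness[where f' = "\<lambda>x. inv g \<otimes> x \<otimes> g"])
          (use g in \<open>auto simp: m_assoc inv_mult_cancel\<close>)
    qed
    then have c: "topological_iso (G\<lparr>carrier := carrier G\<rparr>) (subtopology T (carrier G))
        (G\<lparr>carrier := carrier G\<rparr>) (subtopology T (carrier G)) ?c"
      using homeomorphic_map_conj[OF g] subtopology_topspace[of T] topspace_eq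
      by (simp add: topological_iso_def)
    have "closedin T (carrier G)" using closedin_topspace[of T] topspace_eq by simp
    then have "?c ` ?R \<subseteq> ?R"
      using image_class_radical_subset[OF X c subgroup_self _ closed_subnormal.whole]
        subgroup.subset[OF class_radical_subgroup(1)] by blast
    then show ?thesis using x by blast
  qed
  then show ?thesis
    using normal_inv_iff[of ?R] class_radical_subgroup[of \<X>] by (simp add: closed_normal_def)
qed

text \<open>If an isomorphism between subgroups moves a radical into a normal subgroup of \<open>G\<close> that its
  codomain contains, then the image is subnormal in \<open>G\<close> and therefore inside the radical.\<close>

lemma radical_image_subset:
  assumes f: "topological_iso (G\<lparr>carrier := H\<rparr>) (subtopology T H) (G\<lparr>carrier := K\<rparr>) (subtopology T K) f"
    and H: "subgroup H G" and K: "subgroup K G" "closedin T K"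
    and R: "is_radical G T R" "R \<subseteq> H"
    and M: "closed_normal G T M" "M \<subseteq> K" "f ` R \<subseteq> M"
  shows "f ` R \<subseteq> R"
proof -
  obtain \<X> where X: "profinite_class \<X>" and R_eq: "R = class_radical \<X> G T"
    using R(1) by (auto simp: is_radical_def)
  note tops = topspace_restrict[OF H] topspace_restrict[OF K(1)]
  have RG: "R \<lhd> G" "closedin T R" and sR: "subgroup R G"
    using class_radical_closed_normal[OF X] class_radical_subgroup(1) R_eq by (auto simp: closed_normal_def)
  have MG: "M \<lhd> G" "closedin T M" using M(1) by (auto simp: closed_normal_def)
  have sM: "subgroup M G" using normal_imp_subgroup[OF MG(1)] .
  have "R \<lhd> G\<lparr>carrier := H\<rparr>" using normal_restrict_supergroup[OF H RG(1) R(2)] .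
  then have "f ` R \<lhd> G\<lparr>carrier := K\<rparr>"
    using iso_normal_subgroup[of f] f subgroup_imp_group[OF H] subgroup_imp_group[OF K(1)]
    unfolding topological_iso_def by blast
  moreover have "subgroup M (G\<lparr>carrier := K\<rparr>)" using subgroup_incl[OF sM K(1) M(2)] .
  ultimately have "f ` R \<lhd> (G\<lparr>carrier := K\<rparr>)\<lparr>carrier := M\<rparr>"
    using group.normal_restrict_supergroup[OF subgroup_imp_group[OF K(1)]] M(3) by blast
  then have "f ` R \<lhd> G\<lparr>carrier := M\<rparr>" by simp
  moreover have "closedin T (f ` R)"
  proof -
    have "closedin (subtopology T H) R" using closedin_subset_topspace RG(2) R(2) by blast
    then have "closedin (subtopology T K) (f ` R)"
      using f homeomorphic_map_closedness[of "subtopology T H" "subtopology T K" f R] closedin_subset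
      unfolding topological_iso_def by blast
    then show ?thesis using closedin_trans_full K(2) by blast
  qed
  moreover have "closed_subnormal G T M"
    using closed_subnormal.step[OF closed_subnormal.whole[of G T], of M] MG by simp
  ultimately have fR: "closed_subnormal G T (f ` R)" using closed_subnormal.step by blast
  have "topological_iso (G\<lparr>carrier := R\<rparr>) (subtopology T R) (G\<lparr>carrier := f ` R\<rparr>) (subtopology T (f ` R)) f"
    using topological_iso_restrict[OF f _ tops, of R] R(2) M(2,3) by (simp add: subtopology_nested)
  then show ?thesis
    using image_class_radical_subset[OF X _ sR RG(2) fR] R_eq by blast
qed

end

locale monoid_just_infinite_profinite_group = just_infinite_profinite_group G T
  for G :: "'a monoid" (structure) and T :: "'a topology"

sublocale monoid_just_infinite_profinite_group \<subseteq> monoid_profinite_group ..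

context monoid_just_infinite_profinite_group
begin

lemma small_radical_exists:
  assumes inf: "infinite {R. is_radical G T R}" and L: "openin T L" "\<one> \<in> L"
  shows "\<exists>R. is_radical G T R \<and> closed_normal G T R \<and> R \<noteq> {\<one>} \<and> R \<subseteq> L"
proof (rule ccontr)
  assume no: "\<nexists>R. is_radical G T R \<and> closed_normal G T R \<and> R \<noteq> {\<one>} \<and> R \<subseteq> L"
  have "closed_normal G T R" if "is_radical G T R" for R
    using that class_radical_closed_normal unfolding is_radical_def by blast
  then have "{R. is_radical G T R} \<subseteq> insert {\<one>} {N. closed_normal G T N \<and> \<not> N \<subseteq> L}" using no by blast
  moreover have "finite (insert {\<one>} {N. closed_normal G T N \<and> \<not> N \<subseteq> L})"
    using finitely_many_closed_normal_not_below[OF L] by simp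
  ultimately show False using inf by (simp add: finite_subset)
qed

text \<open>Given an isomorphism \<open>f\<close> of \<open>H\<close> onto \<open>K\<close>, take a non-trivial radical \<open>M\<close> inside \<open>H \<inter> K\<close>, and
  then a non-trivial radical \<open>R\<close> so small that \<open>f\<close> and its inverse both move \<open>R\<close> into \<open>M\<close>. Then
  \<open>f(R) = R\<close>, and both indices are determined by \<open>|G : R|\<close> and \<open>|H : R| = |K : R|\<close>.\<close>

theorem index_stable:
  assumes inf: "infinite {R. is_radical G T R}"
  shows "index_stable G T"
proof -
  have "card (rcosets H) = card (rcosets K)"
    if H: "open_subgroup G T H" and K: "open_subgroup G T K"
      and iso: "top_isomorphic (G\<lparr>carrier := H\<rparr>) (subtopology T H) (G\<lparr>carrier := K\<rparr>) (subtopology T K)"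
    for H K
  proof -
    obtain f where f: "topological_iso (G\<lparr>carrier := H\<rparr>) (subtopology T H)
        (G\<lparr>carrier := K\<rparr>) (subtopology T K) f" using iso top_isomorphic_iff by blast
    have sH: "subgroup H G" "openin T H" and sK: "subgroup K G" "openin T K"
      using H K by (auto simp: open_subgroup_def)
    note gH = subgroup_imp_group[OF sH(1)] and gK = subgroup_imp_group[OF sK(1)]
    note tops = topspace_restrict[OF sH(1)] topspace_restrict[OF sK(1)]
    note cH = open_subgroup_closedin[OF sH] and cK = open_subgroup_closedin[OF sK]
    have fiso: "f \<in> iso (G\<lparr>carrier := H\<rparr>) (G\<lparr>carrier := K\<rparr>)"
      and homeo: "homeomorphic_map (subtopology T H) (subtopology T K) f"
      and inj: "inj_on f H" and fH: "f ` H = K"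
      using f by (auto simp: topological_iso_def iso_def bij_betw_def)
    have "group_hom (G\<lparr>carrier := H\<rparr>) (G\<lparr>carrier := K\<rparr>) f"
      using fiso gH gK by (simp add: iso_def group_hom_def group_hom_axioms_def)
    then have f1: "f \<one> = \<one>" using group_hom.hom_one by fastforce
    let ?g = "inv_into H f"
    have g: "topological_iso (G\<lparr>carrier := K\<rparr>) (subtopology T K) (G\<lparr>carrier := H\<rparr>) (subtopology T H) ?g"
      using topological_iso_inverse[OF f gH tops] by simp
    obtain M where M: "closed_normal G T M" "M \<noteq> {\<one>}" "M \<subseteq> H \<inter> K"
      using small_radical_exists[OF inf, of "H \<inter> K"] sH sK subgroup.one_closed by blast
    have oM: "openin T M" using closed_normal_openin[OF M(1,2)] .
    have M1: "\<one> \<in> M" using subgroup.one_closed[OF closed_normal_subgroup[OF M(1)]] .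
    define L where "L = f ` M \<inter> {x \<in> H. f x \<in> M}"
    have "openin T (f ` M)"
    proof -
      have "openin (subtopology T H) M" using oM M(3) sH(2) by (simp add: openin_open_subtopology)
      then have "openin (subtopology T K) (f ` M)"
        using homeomorphic_map_openness[OF homeo, of M] openin_subset by blast
      then show ?thesis using openin_trans_full sK(2) by blast
    qed
    moreover have "openin T {x \<in> H. f x \<in> M}"
    proof -
      have "continuous_map (subtopology T H) T f"
        using homeomorphic_imp_continuous_map[OF homeo] continuous_map_in_subtopology by blast
      then have "openin (subtopology T H) {x \<in> topspace (subtopology T H). f x \<in> M}"
        using openin_continuous_map_preimage oM by blast
      then have "openin (subtopology T H) {x \<in> H. f x \<in> M}" using tops(1) by (simp del: topspace_subtopology)
      then show ?thesis using openin_trans_full sH(2) by blast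
    qed
    ultimately have "openin T L" unfolding L_def by (rule openin_Int)
    moreover have "\<one> \<in> L"
      using f1 M1 subgroup.one_closed[OF sH(1)] unfolding L_def by (auto intro: image_eqI[of _ _ \<one>])
    ultimately obtain R where R: "is_radical G T R" "closed_normal G T R" "R \<noteq> {\<one>}" "R \<subseteq> L"
      using small_radical_exists[OF inf] by blast
    have sR: "subgroup R G" using closed_normal_subgroup[OF R(2)] .
    have RH: "R \<subseteq> H" using R(4) by (auto simp: L_def)
    have RfM: "R \<subseteq> f ` M" using R(4) by (auto simp: L_def)
    have RK: "R \<subseteq> K" using RfM M(3) fH by blast
    have "f ` R \<subseteq> M" using R(4) by (auto simp: L_def)
    then have sub: "f ` R \<subseteq> R"
      using radical_image_subset[OF f sH(1) sK(1) cK R(1) RH M(1)] M(3) by blast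
    have gf: "?g (f x) = x" if "x \<in> H" for x using inv_into_f_f[OF inj that] .
    have "?g ` R \<subseteq> M"
    proof
      fix y assume "y \<in> ?g ` R"
      then obtain x where x: "x \<in> M" "y = ?g (f x)" using RfM by blast
      moreover have "x \<in> H" using x(1) M(3) by blast
      ultimately show "y \<in> M" using gf[of x] by simp
    qed
    then have gR: "?g ` R \<subseteq> R"
      using radical_image_subset[OF g sK(1) sH(1) cH R(1) RK M(1)] M(3) by blast
    have "R \<subseteq> f ` R"
    proof
      fix y assume y: "y \<in> R"
      then have "f (?g y) = y" using f_inv_into_f[of y f H] RK fH by blast
      then show "y \<in> f ` R" using gR y by (metis image_eqI image_subset_iff)
    qed
    then have eq: "f ` R = R" using sub by blast
    have "card (rcosets\<^bsub>G\<lparr>carrier := K\<rparr>\<^esub> R) = card (rcosets\<^bsub>G\<lparr>carrier := H\<rparr>\<^esub> R)"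
      using iso_index[OF gH gK fiso subgroup_incl[OF sR sH(1) RH]] eq by simp
    moreover have "card (rcosets R) = card (rcosets H) * card (rcosets\<^bsub>G\<lparr>carrier := H\<rparr>\<^esub> R)"
      using index_mult[OF sR sH(1) RH] .
    moreover have "card (rcosets R) = card (rcosets K) * card (rcosets\<^bsub>G\<lparr>carrier := K\<rparr>\<^esub> R)"
      using index_mult[OF sR sK(1) RK] .
    moreover have "0 < card (rcosets R)"
    proof -
      have "R #> \<one> \<in> rcosets R" by (auto simp: RCOSETS_def)
      then show ?thesis using closed_normal_finite_index[OF R(2,3)] card_gt_0_iff by blast
    qed
    ultimately show ?thesis by (metis mult_cancel2 less_numeral_extra(3) mult_is_0)
  qed
  then show ?thesis unfolding index_stable_def index_unstable_def by blast
qed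

end

section \<open>Both parts for a just infinite profinite group\<close>

theorem theoremE:
  fixes G :: "'a monoid" and T :: "'a topology"
  assumes "profinite_group G T" and "just_infinite G T"
  shows "((\<exists>H. open_subgroup G T H \<and> H \<noteq> carrier G \<and>
             top_isomorphic (G\<lparr>carrier := H\<rparr>) (subtopology T H) G T)
           \<longrightarrow> virtually_abelian G T) \<and>
         (infinite {R. is_radical G T R} \<longrightarrow> index_stable G T)"
proof (intro conjI impI)
  interpret profinite_group G T by (rule assms(1))
  interpret monoid_just_infinite_profinite_group G T
    by unfold_locales (rule assms(2))
  show "index_stable G T" if "infinite {R. is_radical G T R}" using index_stable[OF that] .
  assume "\<exists>H. open_subgroup G T H \<and> H \<noteq> carrier G \<and>
             top_isomorphic (G\<lparr>carrier := H\<rparr>) (subtopology T H) G T"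
  then obtain H f where H: "subgroup H G" "openin T H" "H \<noteq> carrier G"
    and f: "topological_iso (G\<lparr>carrier := H\<rparr>) (subtopology T H) G T f"
    unfolding open_subgroup_def top_isomorphic_iff by blast
  have "topological_iso G T (G\<lparr>carrier := H\<rparr>) (subtopology T H) (inv_into H f)"
    using topological_iso_inverse[OF f subgroup_imp_group[OF H(1)] topspace_restrict[OF H(1)] topspace_eq]
    by simp
  then interpret proper_self_embedding G T H "inv_into H f"
    using H by (intro proper_self_embedding.intro proper_self_embedding_axioms.intro
        just_infinite_profinite_group_axioms)
  show "virtually_abelian G T" by (rule virtually_abelian)
qed

end
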